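(* Let $k$ be a positive integer. A vertex-minor ideal $\mathcal C$ is rank $k$-scattered if and only if \[\{H,2H,3H,4H,\ldots\}\not\subseteq\mathcal C\] for every connected graph $H$ on $k+1$ vertices.
   Context: All graphs are finite, undirected and simple. For a finite set $X$ and $f:2^X\to\mathbb Z$, the $f$-width of a partition $(X_1,\ldots,X_m)$ of $X$ is $\max\{f(\bigcup_{i\in I}X_i): I\subseteq\{1,\ldots,m\}\}$; the $k$-brittleness of $f$ is the minimum $f$-width over all partitions of $X$ into parts of size at most $k$. For a graph $G$ and $S\subseteq V(G)$, let $\rho_G(S)$ (the cut-rank) be the rank over the binary field of the $S\times(V(G)\setminus S)$ $0$-$1$ matrix whose $(a,b)$-entry is $1$ if and only if $a$ and $b$ are adjacent. The rank $k$-brittleness of $G$ is the $k$-brittleness of $\rho_G:2^{V(G)}\to\mathbb Z$. A class $\mathcal C$ of graphs is rank $k$-scattered if the rank $k$-brittleness of graphs in $\mathcal C$ is bounded (by a constant depending only on $\mathcal C$). Local complementation at a vertex $v$ of $G$ replaces the subgraph of $G$ induced on the neighbors of $v$ by its complement. Two graphs are locally equivalent if one is obtained from the other by a sequence of local complementations. A graph $H$ is a vertex-minor of $G$ if $H$ is an induced subgraph of a graph locally equivalent to $G$. A class $\mathcal C$ of graphs is a vertex-minor ideal if it contains every graph isomorphic to a vertex-minor of a graph in $\mathcal C$. $mH$ denotes the disjoint union of $m$ copies of $H$. *)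

theory Defs
  imports
    "Graph_Theory.Graph_Theory"
    "HOL-Library.Disjoint_Sets"
    "HOL-Library.Function_Algebras"
    "HOL-Library.Infinite_Typeclass"
    "HOL-Library.Z2"
begin

text \<open>
  A finite simple undirected graph is a \<open>pair_graph\<close> of \<open>Graph_Theory\<close>: an edge \<open>uv\<close> is represented
  by the two arcs \<open>(u, v)\<close> and \<open>(v, u)\<close>.  The null graph is allowed.

  A class of graphs is a set of graphs whose vertices are taken from one infinite type.  As all
  graphs are finite, such a type hosts a copy of every graph, so that isomorphism-closed classes
  are exactly represented.
\<close>

section \<open>Width and brittleness\<close>

definition f_width :: "('a set \<Rightarrow> int) \<Rightarrow> 'a set set \<Rightarrow> int" where
  "f_width f P = Max {f (\<Union>I) | I. I \<subseteq> P}"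

text \<open>Partitions are sets of nonempty parts; empty parts would change neither the unions of parts
  nor the bound on the size of the parts.\<close>

definition brittleness :: "nat \<Rightarrow> 'a set \<Rightarrow> ('a set \<Rightarrow> int) \<Rightarrow> int" where
  "brittleness k X f = Min {f_width f P | P. partition_on X P \<and> (\<forall>Y\<in>P. card Y \<le> k)}"

lemma finite_f_width_values:
  assumes "finite X" "partition_on X P"
  shows "finite {f (\<Union>I) | I. I \<subseteq> P}" "{f (\<Union>I) | I. I \<subseteq> P} \<noteq> {}"
  using finite_elements[OF assms] by auto

lemma finite_brittleness_values:
  assumes "finite X" "k \<ge> 1"
  shows "finite {f_width f P | P. partition_on X P \<and> (\<forall>Y\<in>P. card Y \<le> k)}"
    and "{f_width f P | P. partition_on X P \<and> (\<forall>Y\<in>P. card Y \<le> k)} \<noteq> {}"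
proof -
  have "{P. partition_on X P} \<subseteq> Pow (Pow X)"
    by (auto simp: partition_on_def)
  then have "finite {P. partition_on X P}"
    using assms by (meson finite_Pow_iff finite_subset)
  then show "finite {f_width f P | P. partition_on X P \<and> (\<forall>Y\<in>P. card Y \<le> k)}"
    by auto
  have "partition_on X ((\<lambda>x. {x}) ` X)"
    by (auto simp: partition_on_def disjoint_def)
  then show "{f_width f P | P. partition_on X P \<and> (\<forall>Y\<in>P. card Y \<le> k)} \<noteq> {}"
    using assms by fastforce
qed

section \<open>Cut-rank\<close>

text \<open>The rank of the \<open>A \<times> B\<close> matrix with entries \<open>M a b\<close>: the dimension of its row space, where
  rows are functions vanishing outside \<open>B\<close>.\<close>

definition matrix_rank_on :: "'a set \<Rightarrow> 'b set \<Rightarrow> ('a \<Rightarrow> 'b \<Rightarrow> 'f::field) \<Rightarrow> nat" where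
  "matrix_rank_on A B M =
    vector_space.dim (\<lambda>c v b. c * v b) ((\<lambda>a b. if b \<in> B then M a b else 0) ` A)"

lemma vector_space_fun: "vector_space (\<lambda>(c::'f::field) (v::'b \<Rightarrow> 'f) b. c * v b)"
  by unfold_locales (auto simp: fun_eq_iff algebra_simps)

definition cut_rank :: "'a pair_pre_digraph \<Rightarrow> 'a set \<Rightarrow> int" where
  "cut_rank G S =
    int (matrix_rank_on S (pverts G - S) (\<lambda>a b. if (a, b) \<in> parcs G then 1 else 0 :: bit))"

definition rank_brittleness :: "nat \<Rightarrow> 'a pair_pre_digraph \<Rightarrow> int" where
  "rank_brittleness k G = brittleness k (pverts G) (cut_rank G)"

definition rank_scattered :: "nat \<Rightarrow> 'a pair_pre_digraph set \<Rightarrow> bool" where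
  "rank_scattered k \<C> \<longleftrightarrow> (\<exists>c. \<forall>G\<in>\<C>. rank_brittleness k G \<le> c)"

section \<open>Vertex-minors\<close>

definition local_complement :: "'a pair_pre_digraph \<Rightarrow> 'a \<Rightarrow> 'a pair_pre_digraph" where
  "local_complement G v =
    (let N = {u. (v, u) \<in> parcs G} in
      \<lparr>pverts = pverts G,
       parcs = (parcs G - N \<times> N) \<union> {(x, y). x \<in> N \<and> y \<in> N \<and> x \<noteq> y \<and> (x, y) \<notin> parcs G}\<rparr>)"

text \<open>On simple graphs local complementation is an involution (see below), so that this reflexive
  transitive closure is symmetric.\<close>

definition locally_equivalent :: "'a pair_pre_digraph \<Rightarrow> 'a pair_pre_digraph \<Rightarrow> bool" where
  "locally_equivalent = (\<lambda>G G'. \<exists>v\<in>pverts G. G' = local_complement G v)\<^sup>*\<^sup>*"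

definition vertex_minor :: "'a pair_pre_digraph \<Rightarrow> 'a pair_pre_digraph \<Rightarrow> bool" where
  "vertex_minor H G \<longleftrightarrow>
    (\<exists>G'. locally_equivalent G G' \<and> induced_subgraph (with_proj H) (with_proj G'))"

abbreviation graph_iso :: "'a pair_pre_digraph \<Rightarrow> 'b pair_pre_digraph \<Rightarrow> bool" where
  "graph_iso G H \<equiv> digraph_iso (with_proj G) (with_proj H)"

definition vertex_minor_ideal :: "'a pair_pre_digraph set \<Rightarrow> bool" where
  "vertex_minor_ideal \<C> \<longleftrightarrow>
    (\<forall>G\<in>\<C>. pair_graph G) \<and>
    (\<forall>G\<in>\<C>. \<forall>H H'. vertex_minor H G \<and> graph_iso H H' \<longrightarrow> H' \<in> \<C>)"

text \<open>The graph \<open>mH\<close>, with vertices \<open>(i, u)\<close> where \<open>i\<close> is the number of the copy of \<open>H\<close>.  Its vertex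
  type differs from that of \<open>H\<close>, so membership in a class is up to isomorphism.\<close>

definition copies :: "nat \<Rightarrow> 'a pair_pre_digraph \<Rightarrow> (nat \<times> 'a) pair_pre_digraph" where
  "copies m H =
    \<lparr>pverts = {..<m} \<times> pverts H,
     parcs = {((i, u), (i, v)) | i u v. i < m \<and> (u, v) \<in> parcs H}\<rparr>"

definition contains_graph :: "'a pair_pre_digraph set \<Rightarrow> 'b pair_pre_digraph \<Rightarrow> bool" where
  "contains_graph \<C> H \<longleftrightarrow> (\<exists>G\<in>\<C>. graph_iso G H)"

lemma pair_graph_iff:
  "pair_graph G \<longleftrightarrow>
    finite (pverts G) \<and> parcs G \<subseteq> pverts G \<times> pverts G \<and> sym (parcs G) \<and> irrefl (parcs G)"
proof
  assume "pair_graph G"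
  then interpret pair_graph G .
  show "finite (pverts G) \<and> parcs G \<subseteq> pverts G \<times> pverts G \<and> sym (parcs G) \<and> irrefl (parcs G)"
    using pair_finite_verts in_arcsD1 in_arcsD2 arcs_symmetric no_loops'
    by (fastforce simp: sym_def irrefl_def)
next
  assume *: "finite (pverts G) \<and> parcs G \<subseteq> pverts G \<times> pverts G \<and> sym (parcs G) \<and> irrefl (parcs G)"
  then have "finite (parcs G)"
    by (meson finite_SigmaI finite_subset)
  with * show "pair_graph G"
    by unfold_locales (auto simp: symmetric_def irrefl_def)
qed

lemma pair_graph_local_complement: "pair_graph G \<Longrightarrow> pair_graph (local_complement G v)"
  by (auto simp: pair_graph_iff local_complement_def Let_def sym_def irrefl_def)

lemma local_complement_involution:
  "pair_graph G \<Longrightarrow> local_complement (local_complement G v) v = G"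
  by (rule pair_pre_digraph.equality)
    (auto simp: pair_graph_iff local_complement_def Let_def sym_def irrefl_def)

lemma pair_graph_copies: "pair_graph H \<Longrightarrow> pair_graph (copies m H)"
  by (auto simp: pair_graph_iff copies_def sym_def irrefl_def)

end

theory Submission
  imports Defs "HOL-Library.Ramsey"
begin

text \<open>
  If \<open>m\<close> disjoint copies of a connected graph on \<open>k + 1\<close> vertices sit in a graph, every partition into
  parts of size at most \<open>k\<close> splits all copies, and a union of parts chosen as a large cut separates
  at least half of them.  Each separated copy contributes an edge across the cut, and these edges
  form an induced matching, hence an identity submatrix (\<open>card_pieces_le_if_narrow\<close>).

  For the converse call a \<open>k\<close>-piece a connected set of \<open>k\<close> vertices; pieces always come in families that
  are disjoint and pairwise non-adjacent.  The claim is that large rank \<open>k\<close>-brittleness yields, after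
  local complementations, many \<open>(k + 1)\<close>-pieces (\<open>wide_has_pieces\<close>); many of them are then copies of
  the same graph, as there are finitely many graphs on \<open>k + 1\<close> vertices.  The proof is by induction
  on \<open>k\<close> and rests on three facts.

  \<^item> Perturbations can be undone (\<open>remove_perturbation\<close>).  Suppose that a graph is obtained from a
    disjoint union of pieces by toggling all pairs of vertices according to the classes of their
    ends, for boundedly many classes.  The toggling is a symmetric matrix of bounded rank over the
    binary field.  Local complementation at a vertex, or a pivot, subtracts a matrix of rank one
    or two, and costs only the pieces that contain the vertices used.

  \<^item> Rank between pieces and the rest produces larger pieces (\<open>extend_pieces\<close>).  Let \<open>X\<close> be the union of
    many \<open>k\<close>-pieces.  If the vertices of \<open>X\<close> have many different neighbourhoods outside \<open>X\<close>, then Ramsey's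
    theorem gives a homogeneous sequence of pieces \<open>X\<^sub>i\<close> and outside vertices \<open>y\<^sub>i\<close>, in which
    the own piece, the earlier pieces and the later pieces do not all look the same to \<open>y\<^sub>i\<close>.  If earlier
    and later pieces look the same, the interaction of distinct indices is a perturbation as above; otherwise the structure
    resembles a half graph and pivots cut it into \<open>(k + 1)\<close>-pieces.

  \<^item> Few neighbourhoods cost little.  If the vertices of \<open>X\<close> have boundedly many neighbourhoods outside \<open>X\<close>,
    then the brittleness of the whole graph exceeds that of the rest by at most a bounded amount
    (\<open>narrow_extend\<close>).  By induction, local complementations outside \<open>X\<close> create many new \<open>k\<close>-pieces there.
    They disturb \<open>X\<close> only by toggling between the boundedly many neighbourhood classes, so that old and new
    pieces can be combined, losing boundedly many (\<open>merge_pieces\<close>).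

  Now take a locally equivalent graph with the maximum number of \<open>k\<close>-pieces.  The third fact would
  increase this number, so the second fact applies (\<open>enlarge_pieces\<close>).
\<close>

section \<open>Local complementation of adjacency relations\<close>

definition sgraph :: "('a \<Rightarrow> 'a \<Rightarrow> bool) \<Rightarrow> bool" where
  "sgraph E \<longleftrightarrow> (\<forall>x y. E x y \<longleftrightarrow> E y x) \<and> (\<forall>x. \<not> E x x)"

text \<open>Graphs are handled as adjacency relations on the whole type.  Local complementation at a
  vertex of \<open>V\<close> changes adjacency inside \<open>V\<close> in a way that depends only on
  adjacency inside \<open>V\<close>.  Deleting vertices therefore amounts to restricting attention
  to a smaller set, and operations performed in an induced subgraph lift to the graph without
  further argument.\<close>

definition lc :: "('a \<Rightarrow> 'a \<Rightarrow> bool) \<Rightarrow> 'a \<Rightarrow> 'a \<Rightarrow> 'a \<Rightarrow> bool" where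
  "lc E v = (\<lambda>x y. E x y \<noteq> (x \<noteq> y \<and> E v x \<and> E v y))"

definition loc_equiv :: "'a set \<Rightarrow> ('a \<Rightarrow> 'a \<Rightarrow> bool) \<Rightarrow> ('a \<Rightarrow> 'a \<Rightarrow> bool) \<Rightarrow> bool" where
  "loc_equiv V = (\<lambda>E E'. \<exists>v\<in>V. E' = lc E v)\<^sup>*\<^sup>*"

definition pivot :: "('a \<Rightarrow> 'a \<Rightarrow> bool) \<Rightarrow> 'a \<Rightarrow> 'a \<Rightarrow> 'a \<Rightarrow> 'a \<Rightarrow> bool" where
  "pivot E u v = lc (lc (lc E u) v) u"

lemma sgraph_lc: "sgraph E \<Longrightarrow> sgraph (lc E v)"
  by (auto simp: sgraph_def lc_def)

lemma lc_lc: "sgraph E \<Longrightarrow> lc (lc E v) v = E"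
  by (auto simp: sgraph_def lc_def fun_eq_iff)

lemma loc_equiv_refl: "loc_equiv V E E"
  by (simp add: loc_equiv_def)

lemma loc_equiv_trans: "loc_equiv V E E' \<Longrightarrow> loc_equiv V E' E'' \<Longrightarrow> loc_equiv V E E''"
  by (simp add: loc_equiv_def)

lemma loc_equiv_lc: "v \<in> V \<Longrightarrow> loc_equiv V E (lc E v)"
  unfolding loc_equiv_def by blast

lemma loc_equiv_pivot: "u \<in> V \<Longrightarrow> v \<in> V \<Longrightarrow> loc_equiv V E (pivot E u v)"
  unfolding pivot_def by (meson loc_equiv_lc loc_equiv_trans)

lemma loc_equiv_mono: "loc_equiv V E E' \<Longrightarrow> V \<subseteq> W \<Longrightarrow> loc_equiv W E E'"
  unfolding loc_equiv_def by (rule rtranclp_mono[THEN predicate2D]) auto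

lemma loc_equiv_induct [consumes 1, case_names refl step]:
  assumes "loc_equiv V E E'" "Q E"
    and "\<And>E' v. loc_equiv V E E' \<Longrightarrow> Q E' \<Longrightarrow> v \<in> V \<Longrightarrow> Q (lc E' v)"
  shows "Q E'"
  using assms(1) unfolding loc_equiv_def
  by (induction rule: rtranclp_induct) (use assms in \<open>auto simp: loc_equiv_def\<close>)

lemma sgraph_loc_equiv: "loc_equiv V E E' \<Longrightarrow> sgraph E \<Longrightarrow> sgraph E'"
  by (induction rule: loc_equiv_induct) (auto simp: sgraph_lc)

lemma loc_equiv_sym: "loc_equiv V E E' \<Longrightarrow> sgraph E \<Longrightarrow> loc_equiv V E' E"
proof (induction rule: loc_equiv_induct)
  case refl
  then show ?case by (simp add: loc_equiv_refl)
next
  case (step E' v)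
  then show ?case
    by (metis loc_equiv_lc loc_equiv_trans lc_lc sgraph_loc_equiv)
qed

text \<open>Over the binary field, pivoting on \<open>uv\<close> adds to the adjacency matrix the
  symmetric matrix \<open>a\<^sub>u a\<^sub>v\<^sup>T + a\<^sub>v a\<^sub>u\<^sup>T\<close>, where
  \<open>a\<^sub>w\<close> is the row of \<open>w\<close>.  Local complementation at
  \<open>u\<close> adds \<open>a\<^sub>u a\<^sub>u\<^sup>T\<close>.\<close>

lemma pivot_apply:
  assumes "sgraph E" "E u v" "x \<noteq> y" "x \<noteq> u" "x \<noteq> v" "y \<noteq> u" "y \<noteq> v"
  shows "pivot E u v x y = (E x y \<noteq> ((E u x \<and> E v y) \<noteq> (E v x \<and> E u y)))"
proof -
  have "u \<noteq> v" "E v u" "\<not> E u u" "\<not> E v v" using assms by (auto simp: sgraph_def)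
  then show ?thesis using assms(2-)
    unfolding pivot_def lc_def by auto
qed

lemma sgraph_pivot: "sgraph E \<Longrightarrow> sgraph (pivot E u v)"
  by (simp add: pivot_def sgraph_lc)

section \<open>Removing a perturbation of low rank\<close>

lemma card_active_less:
  assumes "finite (c ` W)" "W' \<subseteq> W"
    and "\<And>\<kappa>. \<kappa> \<in> c ` W' \<Longrightarrow> \<exists>\<kappa>'\<in>c ` W'. P' \<kappa> \<kappa>' \<Longrightarrow> \<exists>\<kappa>'\<in>c ` W. P \<kappa> \<kappa>'"
    and "\<kappa>\<^sub>0 \<in> c ` W" "\<exists>\<kappa>'\<in>c ` W. P \<kappa>\<^sub>0 \<kappa>'"
    and "\<kappa>\<^sub>0 \<in> c ` W' \<Longrightarrow> \<not> (\<exists>\<kappa>'\<in>c ` W'. P' \<kappa>\<^sub>0 \<kappa>')"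
  shows "card {\<kappa> \<in> c ` W'. \<exists>\<kappa>'\<in>c ` W'. P' \<kappa> \<kappa>'} < card {\<kappa> \<in> c ` W. \<exists>\<kappa>'\<in>c ` W. P \<kappa> \<kappa>'}"
proof (rule psubset_card_mono)
  show "finite {\<kappa> \<in> c ` W. \<exists>\<kappa>'\<in>c ` W. P \<kappa> \<kappa>'}" using assms(1) by simp
  show "{\<kappa> \<in> c ` W'. \<exists>\<kappa>'\<in>c ` W'. P' \<kappa> \<kappa>'} \<subset> {\<kappa> \<in> c ` W. \<exists>\<kappa>'\<in>c ` W. P \<kappa> \<kappa>'}"
  proof
    show "{\<kappa> \<in> c ` W'. \<exists>\<kappa>'\<in>c ` W'. P' \<kappa> \<kappa>'} \<subseteq> {\<kappa> \<in> c ` W. \<exists>\<kappa>'\<in>c ` W. P \<kappa> \<kappa>'}"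
      using assms(2,3) by blast
    show "{\<kappa> \<in> c ` W'. \<exists>\<kappa>'\<in>c ` W'. P' \<kappa> \<kappa>'} \<noteq> {\<kappa> \<in> c ` W. \<exists>\<kappa>'\<in>c ` W. P \<kappa> \<kappa>'}"
      using assms(4-6) by blast
  qed
qed

text \<open>The induction is on the number of classes with a nonzero row of \<open>P\<close>, which
  plays the role of the rank.  If \<open>P \<kappa> \<kappa>\<close> holds for the class
  \<open>\<kappa>\<close> of some vertex \<open>u\<close>, local complementation at \<open>u\<close>
  clears the row of \<open>\<kappa>\<close>; outside its own piece, \<open>u\<close> sees exactly
  what \<open>P\<close> prescribes, so that \<open>B\<close> does not change there.  If the diagonal
  vanishes, a pivot on two vertices of classes with \<open>P \<kappa> \<kappa>'\<close> does the
  same, provided that they lie in different pieces; otherwise deleting one piece exhausts a class.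
  At most two pieces are lost in each step.\<close>

lemma remove_perturbation:
  assumes "finite F" "disjoint F" "sgraph E" "finite (c ` \<Union>F)" "\<And>\<kappa> \<kappa>'. P \<kappa> \<kappa>' \<longleftrightarrow> P \<kappa>' \<kappa>"
    and "\<And>S T x y. S \<in> F \<Longrightarrow> T \<in> F \<Longrightarrow> x \<in> S \<Longrightarrow> y \<in> T \<Longrightarrow> x \<noteq> y \<Longrightarrow>
      E x y = ((S = T \<and> B x y) \<noteq> P (c x) (c y))"
  shows "\<exists>E' F'. F' \<subseteq> F \<and> card F \<le> card F' + 2 * card (c ` \<Union>F) \<and> loc_equiv (\<Union>F) E E' \<and>
    (\<forall>S\<in>F'. \<forall>T\<in>F'. \<forall>x\<in>S. \<forall>y\<in>T. x \<noteq> y \<longrightarrow> E' x y = (S = T \<and> B x y))"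
proof -
  let ?act = "\<lambda>F P. card {\<kappa> \<in> c ` \<Union>F. \<exists>\<kappa>'\<in>c ` \<Union>F. P \<kappa> \<kappa>'}"
  have "\<exists>E' F'. F' \<subseteq> F \<and> card F \<le> card F' + 2 * ?act F P \<and> loc_equiv (\<Union>F) E E' \<and>
    (\<forall>S\<in>F'. \<forall>T\<in>F'. \<forall>x\<in>S. \<forall>y\<in>T. x \<noteq> y \<longrightarrow> E' x y = (S = T \<and> B x y))"
    using assms
  proof (induction "?act F P" arbitrary: E F P rule: less_induct)
    case less
    note fin = \<open>finite F\<close> and disj = \<open>disjoint F\<close> and E = \<open>sgraph E\<close> and finc = \<open>finite (c ` \<Union>F)\<close>
      and P = less.prems(5) and EB = less.prems(6)
    have same: "S = T" if "S \<in> F" "T \<in> F" "x \<in> S" "x \<in> T" for S T x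
      using disj that unfolding disjoint_def by blast
    have ind: ?case
      if "R \<subseteq> F" "card R \<le> 2" "loc_equiv (\<Union>F) E E1" "sgraph E1"
        and act: "?act (F - R) P1 < ?act F P"
        and P1: "\<And>\<kappa> \<kappa>'. P1 \<kappa> \<kappa>' \<longleftrightarrow> P1 \<kappa>' \<kappa>"
        and E1: "\<And>S T x y. S \<in> F - R \<Longrightarrow> T \<in> F - R \<Longrightarrow> x \<in> S \<Longrightarrow> y \<in> T \<Longrightarrow> x \<noteq> y \<Longrightarrow>
          E1 x y = ((S = T \<and> B x y) \<noteq> P1 (c x) (c y))" for R E1 P1
    proof -
      have "finite (c ` \<Union>(F - R))"
        by (rule finite_subset[OF _ finc]) blast
      moreover have "disjoint (F - R)" using disj by (auto simp: disjoint_def)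
      ultimately obtain E' F' where *: "F' \<subseteq> F - R" "card (F - R) \<le> card F' + 2 * ?act (F - R) P1"
        "loc_equiv (\<Union>(F - R)) E1 E'"
        "\<forall>S\<in>F'. \<forall>T\<in>F'. \<forall>x\<in>S. \<forall>y\<in>T. x \<noteq> y \<longrightarrow> E' x y = (S = T \<and> B x y)"
        using less.hyps[OF act, of E1] fin \<open>sgraph E1\<close> P1 E1 by blast
      have "card F \<le> card (F - R) + card R"
        using card_Diff_subset[of R F] fin \<open>R \<subseteq> F\<close> finite_subset by fastforce
      then have "card F \<le> card F' + 2 * ?act F P"
        using *(2) \<open>card R \<le> 2\<close> act by linarith
      moreover have "loc_equiv (\<Union>F) E E'"
        by (meson *(3) that(3) loc_equiv_mono loc_equiv_trans Union_mono Diff_subset)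
      ultimately show ?thesis using *(1,4) by blast
    qed
    show ?case
    proof (cases "\<exists>u\<in>\<Union>F. P (c u) (c u)")
      case True
      then obtain u S where u: "u \<in> S" "S \<in> F" "P (c u) (c u)" by blast
      define P1 where "P1 \<kappa> \<kappa>' = (P \<kappa> \<kappa>' \<noteq> (P (c u) \<kappa> \<and> P (c u) \<kappa>'))" for \<kappa> \<kappa>'
      show ?thesis
      proof (rule ind[of "{S}" "lc E u" P1])
        show "?act (F - {S}) P1 < ?act F P"
        proof (rule card_active_less[where \<kappa>\<^sub>0 = "c u"])
          show "\<exists>\<kappa>'\<in>c ` \<Union>F. P \<kappa> \<kappa>'" if "\<exists>\<kappa>'\<in>c ` \<Union>(F - {S}). P1 \<kappa> \<kappa>'" for \<kappa>
            using that u P unfolding P1_def by blast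
        qed (use u finc in \<open>auto simp: P1_def\<close>)
        show "lc E u x y = ((S' = T' \<and> B x y) \<noteq> P1 (c x) (c y))"
          if "S' \<in> F - {S}" "T' \<in> F - {S}" "x \<in> S'" "y \<in> T'" "x \<noteq> y" for S' T' x y
        proof -
          have "u \<noteq> x" "u \<noteq> y" "S \<noteq> S'" "S \<noteq> T'" using same u that by blast+
          then have "E u x = P (c u) (c x)" "E u y = P (c u) (c y)"
            "E x y = ((S' = T' \<and> B x y) \<noteq> P (c x) (c y))"
            using EB[of S S' u x] EB[of S T' u y] EB[of S' T' x y] u that by auto
          then show ?thesis using that by (auto simp: lc_def P1_def)
        qed
      qed (use u E P in \<open>auto simp: P1_def sgraph_lc intro!: loc_equiv_lc\<close>)
    next
      case diag: False
      show ?thesis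
      proof (cases "\<exists>u\<in>\<Union>F. \<exists>w\<in>\<Union>F. P (c u) (c w)")
        case True
        then obtain u S w where u: "u \<in> S" "S \<in> F" and w: "w \<in> \<Union>F" "P (c u) (c w)" by blast
        have Pww: "\<not> P (c w) (c w)" and Puu: "\<not> P (c u) (c u)" using diag u w by blast+
        show ?thesis
        proof (cases "c w \<in> c ` \<Union>(F - {S})")
          case False
          show ?thesis
          proof (rule ind[of "{S}" E P])
            show "?act (F - {S}) P < ?act F P"
              by (rule card_active_less[where \<kappa>\<^sub>0 = "c w"]) (use u w False finc P in blast)+
          qed (use u E P EB in \<open>auto simp: loc_equiv_refl\<close>)
        next
          case True
          then obtain v T where v: "v \<in> T" "T \<in> F" "T \<noteq> S" "c v = c w" by fastforce
          have "u \<noteq> v" using same u v by blast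
          have Euv: "E u v" using EB[of S T u v] u v w \<open>u \<noteq> v\<close> by simp
          define P1 where "P1 \<kappa> \<kappa>' =
            (P \<kappa> \<kappa>' \<noteq> ((P (c u) \<kappa> \<and> P (c w) \<kappa>') \<noteq> (P (c w) \<kappa> \<and> P (c u) \<kappa>')))" for \<kappa> \<kappa>'
          show ?thesis
          proof (rule ind[of "{S, T}" "pivot E u v" P1])
            show "?act (F - {S, T}) P1 < ?act F P"
            proof (rule card_active_less[where \<kappa>\<^sub>0 = "c u"])
              show "\<exists>\<kappa>'\<in>c ` \<Union>F. P \<kappa> \<kappa>'" if "\<exists>\<kappa>'\<in>c ` \<Union>(F - {S, T}). P1 \<kappa> \<kappa>'" for \<kappa>
                using that u w P unfolding P1_def by blast
              show "\<not> (\<exists>\<kappa>'\<in>c ` \<Union>(F - {S, T}). P1 (c u) \<kappa>')"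
                using w Puu P[of "c w" "c u"] by (auto simp: P1_def)
            qed (use u w finc in \<open>auto simp: P1_def\<close>)
            show "pivot E u v x y = ((S' = T' \<and> B x y) \<noteq> P1 (c x) (c y))"
              if "S' \<in> F - {S, T}" "T' \<in> F - {S, T}" "x \<in> S'" "y \<in> T'" "x \<noteq> y" for S' T' x y
            proof -
              have ne: "u \<noteq> x" "u \<noteq> y" "v \<noteq> x" "v \<noteq> y" "S \<noteq> S'" "S \<noteq> T'" "T \<noteq> S'" "T \<noteq> T'"
                using same u v that by blast+
              have "E u x = P (c u) (c x)" "E u y = P (c u) (c y)"
                "E v x = P (c w) (c x)" "E v y = P (c w) (c y)"
                "E x y = ((S' = T' \<and> B x y) \<noteq> P (c x) (c y))"
                using EB[of S S' u x] EB[of S T' u y] EB[of T S' v x] EB[of T T' v y]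
                  EB[of S' T' x y] u v that ne by auto
              moreover have "pivot E u v x y = (E x y \<noteq> ((E u x \<and> E v y) \<noteq> (E v x \<and> E u y)))"
                using pivot_apply[OF E Euv \<open>x \<noteq> y\<close>] ne by simp
              moreover have "((a \<noteq> b) \<noteq> d) = (a \<noteq> (b \<noteq> d))" for a b d by blast
              ultimately show ?thesis by (simp only: P1_def)
            qed
            show "P1 \<kappa> \<kappa>' \<longleftrightarrow> P1 \<kappa>' \<kappa>" for \<kappa> \<kappa>'
              using P unfolding P1_def by blast
          qed (use u v E in \<open>auto simp: card_insert_if sgraph_pivot intro!: loc_equiv_pivot\<close>)
        qed
      next
        case False
        have "E x y = (S = T \<and> B x y)" if "S \<in> F" "T \<in> F" "x \<in> S" "y \<in> T" "x \<noteq> y" for S T x y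
          using EB[OF that] False that by blast
        then show ?thesis
          by (intro exI[of _ E] exI[of _ F]) (auto simp: loc_equiv_refl)
      qed
    qed
  qed
  then obtain E' F' where *: "F' \<subseteq> F" "card F \<le> card F' + 2 * ?act F P" "loc_equiv (\<Union>F) E E'"
    "\<forall>S\<in>F'. \<forall>T\<in>F'. \<forall>x\<in>S. \<forall>y\<in>T. x \<noteq> y \<longrightarrow> E' x y = (S = T \<and> B x y)"
    by blast
  have "?act F P \<le> card (c ` \<Union>F)"
    by (rule card_mono[OF assms(4)]) blast
  then have "card F \<le> card F' + 2 * card (c ` \<Union>F)" using *(2) by linarith
  then show ?thesis using *(1,3,4) by blast
qed

section \<open>Scattered connected pieces\<close>

text \<open>Connectedness is phrased through cuts because a cut that splits a piece has to
  contribute to the cut-rank.\<close>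

definition conn :: "('a \<Rightarrow> 'a \<Rightarrow> bool) \<Rightarrow> 'a set \<Rightarrow> bool" where
  "conn E S \<longleftrightarrow> S \<noteq> {} \<and> (\<forall>A. A \<subseteq> S \<and> A \<noteq> {} \<and> A \<noteq> S \<longrightarrow> (\<exists>x\<in>A. \<exists>y\<in>S - A. E x y))"

definition pieces :: "('a \<Rightarrow> 'a \<Rightarrow> bool) \<Rightarrow> nat \<Rightarrow> 'a set set \<Rightarrow> bool" where
  "pieces E k F \<longleftrightarrow> disjoint F \<and> (\<forall>S\<in>F. card S = k \<and> conn E S) \<and>
    (\<forall>S\<in>F. \<forall>T\<in>F. S \<noteq> T \<longrightarrow> (\<forall>x\<in>S. \<forall>y\<in>T. \<not> E x y))"

text \<open>Since \<open>loc_equiv\<close> keeps all vertices, this says that \<open>m\<close>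
  pieces form an induced subgraph of a graph that is locally equivalent to the subgraph induced on
  \<open>V\<close>.\<close>

definition has_pieces :: "'a set \<Rightarrow> ('a \<Rightarrow> 'a \<Rightarrow> bool) \<Rightarrow> nat \<Rightarrow> nat \<Rightarrow> bool" where
  "has_pieces V E k m \<longleftrightarrow> (\<exists>E' F. loc_equiv V E E' \<and> pieces E' k F \<and> \<Union>F \<subseteq> V \<and> m \<le> card F)"

lemma conn_mono:
  assumes "conn E S" "\<And>x y. x \<in> S \<Longrightarrow> y \<in> S \<Longrightarrow> x \<noteq> y \<Longrightarrow> E x y \<Longrightarrow> E' x y"
  shows "conn E' S"
  unfolding conn_def
proof (intro conjI allI impI)
  show "S \<noteq> {}" using assms(1) by (simp add: conn_def)
  fix A assume A: "A \<subseteq> S \<and> A \<noteq> {} \<and> A \<noteq> S"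
  then obtain x y where "x \<in> A" "y \<in> S - A" "E x y"
    using assms(1) unfolding conn_def by metis
  then show "\<exists>x\<in>A. \<exists>y\<in>S - A. E' x y"
    using assms(2)[of x y] A by blast
qed

lemma conn_insert:
  assumes "conn E S" "x \<in> S" "E x y" "E y x"
  shows "conn E (insert y S)"
  unfolding conn_def
proof (intro conjI allI impI)
  fix A assume A: "A \<subseteq> insert y S \<and> A \<noteq> {} \<and> A \<noteq> insert y S"
  show "\<exists>x\<in>A. \<exists>z\<in>insert y S - A. E x z"
  proof (cases "A \<inter> S = {} \<or> S \<subseteq> A")
    case True
    then show ?thesis using A assms(2-4) by blast
  next
    case False
    then have "\<exists>a\<in>A \<inter> S. \<exists>b\<in>S - A \<inter> S. E a b"
      using assms(1) unfolding conn_def by (metis Int_lower2 inf.absorb_iff2 inf.commute)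
    then show ?thesis by blast
  qed
qed simp

lemma has_pieces_mono: "has_pieces V E k m \<Longrightarrow> V \<subseteq> W \<Longrightarrow> has_pieces W E k m"
  unfolding has_pieces_def by (meson loc_equiv_mono order_trans)

lemma has_pieces_loc_equiv: "loc_equiv V E E' \<Longrightarrow> has_pieces V E' k m \<Longrightarrow> has_pieces V E k m"
  unfolding has_pieces_def by (meson loc_equiv_trans)

section \<open>Homogeneous sequences\<close>

lemma ramsey_pairs:
  fixes n :: nat
  assumes "finite C"
  shows "\<exists>N. \<forall>f::nat \<Rightarrow> nat \<Rightarrow> 'c. (\<forall>i j. i < j \<and> j < N \<longrightarrow> f i j \<in> C) \<longrightarrow>
    (\<exists>\<sigma> c. (\<forall>i j. i < j \<and> j < n \<longrightarrow> \<sigma> i < \<sigma> j \<and> f (\<sigma> i) (\<sigma> j) = c) \<and> (\<forall>i<n. \<sigma> i < N))"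
proof -
  obtain N :: nat where N: "partn_lst {..<N} (replicate (card C) n) 2"
    using ramsey_full by blast
  obtain g where g: "bij_betw g C {..<card C}"
    using assms by (metis ex_bij_betw_finite_nat atLeast0LessThan)
  show ?thesis
  proof (intro exI[of _ N] allI impI)
    fix f :: "nat \<Rightarrow> nat \<Rightarrow> 'c"
    assume f: "\<forall>i j. i < j \<and> j < N \<longrightarrow> f i j \<in> C"
    define h where "h e = g (f (Min e) (Max e))" for e
    have "h \<in> nsets {..<N} 2 \<rightarrow> {..<card C}"
    proof
      fix e :: "nat set" assume "e \<in> nsets {..<N} 2"
      then obtain i j where "e = {i, j}" "i < j" "j < N"
        by (auto simp: ordered_nsets_2_eq)
      then show "h e \<in> {..<card C}"
        using f g by (auto simp: h_def bij_betw_def)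
    qed
    from partn_lstE[OF N this length_replicate]
    obtain i H where H: "H \<in> nsets {..<N} n" "h ` nsets H 2 \<subseteq> {i}" "i < card C"
      by (metis length_replicate nth_replicate)
    have H': "H \<subseteq> {..<N}" "finite H" "card H = n" using H(1) by (auto simp: nsets_def)
    define \<sigma> where "\<sigma> i = sorted_list_of_set H ! i" for i
    have len: "length (sorted_list_of_set H) = n" using H' by simp
    have mem: "\<sigma> j \<in> H" if "j < n" for j
      unfolding \<sigma>_def using that len H'(2) by (metis nth_mem set_sorted_list_of_set)
    have mono: "\<sigma> j < \<sigma> l" if "j < l" "l < n" for j l
      unfolding \<sigma>_def using that len
      by (metis sorted_wrt_nth_less strict_sorted_list_of_set)
    have gi: "g (f (\<sigma> j) (\<sigma> l)) = i" if "j < l" "l < n" for j l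
    proof -
      have "{\<sigma> j, \<sigma> l} \<in> nsets H 2" using mem mono that by fastforce
      then have "h {\<sigma> j, \<sigma> l} = i" using H(2) by blast
      then show ?thesis using mono[OF that] by (simp add: h_def)
    qed
    have fC: "f (\<sigma> j) (\<sigma> l) \<in> C" if "j < l" "l < n" for j l
      using f mono[OF that] mem[OF that(2)] H'(1) by blast
    have "f (\<sigma> j) (\<sigma> l) = inv_into C g i" if "j < l" "l < n" for j l
      using gi[OF that] fC[OF that] g by (metis bij_betw_def inv_into_f_f)
    then show "\<exists>\<sigma> c. (\<forall>i j. i < j \<and> j < n \<longrightarrow> \<sigma> i < \<sigma> j \<and> f (\<sigma> i) (\<sigma> j) = c) \<and> (\<forall>i<n. \<sigma> i < N)"
      using mono mem H'(1) by (intro exI[of _ \<sigma>] exI[of _ "inv_into C g i"]) blast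
  qed
qed

lemma tuples_parts:
  assumes inj: "inj_on (case_prod v) (I \<times> {..k})"
  defines "S \<equiv> \<lambda>i. v i ` {..k}"
  shows "disjoint (S ` I)" "\<And>i. i \<in> I \<Longrightarrow> card (S i) = Suc k" "card (S ` I) = card I"
proof -
  have ne: "v i l \<noteq> v j l'" if "i \<in> I" "j \<in> I" "l \<le> k" "l' \<le> k" "(i, l) \<noteq> (j, l')" for i j l l'
    using inj_onD[OF inj, of "(i, l)" "(j, l')"] that by auto
  have dis: "S i \<inter> S j = {}" if "i \<in> I" "j \<in> I" "i \<noteq> j" for i j
    using ne[OF that(1,2)] that(3) unfolding S_def by fastforce
  then show "disjoint (S ` I)" unfolding disjoint_def by blast
  show "card (S i) = Suc k" if "i \<in> I" for i
    using card_image[of "v i" "{..k}"] ne[OF that that] unfolding S_def by (auto simp: inj_on_def)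
  have "S i \<noteq> {}" for i by (simp add: S_def)
  then have "inj_on S I" using dis by (metis inf.idem inj_onI)
  then show "card (S ` I) = card I" by (rule card_image)
qed

lemma pieces_tuples:
  assumes inj: "inj_on (case_prod v) (I \<times> {..k})"
    and cn: "\<And>i. i \<in> I \<Longrightarrow> conn E (v i ` {..k})"
    and cross: "\<And>i j l l'. i \<in> I \<Longrightarrow> j \<in> I \<Longrightarrow> i \<noteq> j \<Longrightarrow> l \<le> k \<Longrightarrow> l' \<le> k \<Longrightarrow> \<not> E (v i l) (v j l')"
  shows "pieces E (k + 1) ((\<lambda>i. v i ` {..k}) ` I)"
  unfolding pieces_def
proof (intro conjI ballI impI)
  fix S T x y
  assume "S \<in> (\<lambda>i. v i ` {..k}) ` I" "T \<in> (\<lambda>i. v i ` {..k}) ` I" "S \<noteq> T" and xy: "x \<in> S" "y \<in> T"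
  then obtain i j where ij: "i \<in> I" "j \<in> I" "i \<noteq> j" "S = v i ` {..k}" "T = v j ` {..k}" by blast
  then show "\<not> E x y" using cross[OF ij(1-3)] xy by auto
qed (use tuples_parts[OF inj] cn in auto)

text \<open>In the tuple \<open>v i\<close>, the entries \<open>v i l\<close> with \<open>l <
  k\<close> enumerate the piece \<open>X\<^sub>i\<close> and \<open>v i k\<close> is the extra
  vertex \<open>y\<^sub>i\<close>.  The patterns \<open>s\<close>, \<open>p\<close> and
  \<open>q\<close> describe how \<open>y\<^sub>i\<close> sees its own piece, later pieces and
  earlier pieces.

  As \<open>p\<close> holds and \<open>q\<close> fails at \<open>l\<^sub>0\<close>, the vertices
  \<open>u = v (3 t + 2) l\<^sub>0\<close> and \<open>w = v (3 t + 1) k\<close> are adjacent, and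
  \<open>u\<close> has \<open>v (3 t) k\<close> as its only other neighbour among the remaining
  vertices.  The pivot on \<open>u w\<close> hence adds the row of \<open>w\<close> to the row of
  \<open>v (3 t) k\<close> and changes nothing else.  Later pieces and extra vertices look the same
  to these two vertices, so that they disappear from the new row; the pieces up to index \<open>3
  t\<close> contribute \<open>q\<close>.  This cancels the adjacency to the pieces separated before
  and turns \<open>s\<close> into \<open>s + q\<close> on the own piece.\<close>

lemma separate_by_pivots:
  fixes v :: "nat \<Rightarrow> nat \<Rightarrow> 'a"
  assumes E: "sgraph E" and inj: "inj_on (case_prod v) ({..<3 * n} \<times> {..k})"
    and XX: "\<And>i j l l'. i < 3 * n \<Longrightarrow> j < 3 * n \<Longrightarrow> i \<noteq> j \<Longrightarrow> l < k \<Longrightarrow> l' < k \<Longrightarrow> \<not> E (v i l) (v j l')"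
    and p: "\<And>i j l. i < j \<Longrightarrow> j < 3 * n \<Longrightarrow> l < k \<Longrightarrow> E (v i k) (v j l) = p l"
    and q: "\<And>i j l. i < j \<Longrightarrow> j < 3 * n \<Longrightarrow> l < k \<Longrightarrow> E (v j k) (v i l) = q l"
    and e: "\<And>i j. i < j \<Longrightarrow> j < 3 * n \<Longrightarrow> E (v i k) (v j k) = e"
    and s: "\<And>i l. i < 3 * n \<Longrightarrow> l < k \<Longrightarrow> E (v i k) (v i l) = s l"
    and l0: "l\<^sub>0 < k" "p l\<^sub>0" "\<not> q l\<^sub>0"
  shows "\<exists>E'. loc_equiv (case_prod v ` ({..<3 * n} \<times> {..k})) E E' \<and>
    (\<forall>i<n. \<forall>j<n. i \<noteq> j \<longrightarrow> (\<forall>l\<le>k. \<forall>l'\<le>k. \<not> E' (v (3 * i) l) (v (3 * j) l'))) \<and>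
    (\<forall>i<n. \<forall>l<k. E' (v (3 * i) k) (v (3 * i) l) = (s l \<noteq> q l)) \<and>
    (\<forall>i<n. \<forall>l<k. \<forall>l'<k. E' (v (3 * i) l) (v (3 * i) l') = E (v (3 * i) l) (v (3 * i) l'))"
proof -
  let ?V = "case_prod v ` ({..<3 * n} \<times> {..k})"
  have ne: "v i l \<noteq> v j l'" if "i < 3 * n" "j < 3 * n" "l \<le> k" "l' \<le> k" "(i, l) \<noteq> (j, l')" for i j l l'
    using inj_onD[OF inj, of "(i, l)" "(j, l')"] that by auto
  define act where "act t i \<longleftrightarrow> i < 3 * n \<and> (i < 3 * t \<longrightarrow> 3 dvd i)" for t i :: nat
  \<comment> \<open>Indices below \<open>3 t\<close> have been treated: their multiples of 3 survive, the others were used up.\<close>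
  have "t \<le> n \<Longrightarrow> \<exists>E'. loc_equiv ?V E E' \<and>
    (\<forall>i j l l'. act t i \<and> act t j \<and> l < k \<and> l' < k \<longrightarrow> E' (v i l) (v j l') = E (v i l) (v j l')) \<and>
    (\<forall>i j l. act t i \<and> act t j \<and> l < k \<longrightarrow> E' (v i k) (v j l) =
      (if i < 3 * t then i = j \<and> s l \<noteq> q l else if i = j then s l else if i < j then p l else q l)) \<and>
    (\<forall>i j. act t i \<and> act t j \<and> i \<noteq> j \<longrightarrow> E' (v i k) (v j k) = (3 * t \<le> i \<and> 3 * t \<le> j \<and> e))" for t
  proof (induction t)
    case 0
    have "E (v i k) (v j k) = e" if "i < 3 * n" "j < 3 * n" "i \<noteq> j" for i j
      using e[of i j] e[of j i] that E by (metis sgraph_def nat_neq_iff)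
    then show ?case
      using p q s by (intro exI[of _ E]) (auto simp: loc_equiv_refl act_def)
  next
    case (Suc t)
    then obtain E' where E': "loc_equiv ?V E E'"
      and I1: "\<And>i j l l'. act t i \<Longrightarrow> act t j \<Longrightarrow> l < k \<Longrightarrow> l' < k \<Longrightarrow> E' (v i l) (v j l') = E (v i l) (v j l')"
      and I2: "\<And>i j l. act t i \<Longrightarrow> act t j \<Longrightarrow> l < k \<Longrightarrow> E' (v i k) (v j l) =
        (if i < 3 * t then i = j \<and> s l \<noteq> q l else if i = j then s l else if i < j then p l else q l)"
      and I3: "\<And>i j. act t i \<Longrightarrow> act t j \<Longrightarrow> i \<noteq> j \<Longrightarrow> E' (v i k) (v j k) = (3 * t \<le> i \<and> 3 * t \<le> j \<and> e)"
      by force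
    have sE': "sgraph E'" using E' E sgraph_loc_equiv by blast
    then have sym: "E' x y = E' y x" for x y by (simp add: sgraph_def)
    define a b where "a = 3 * t + 2" and "b = 3 * t + 1"
    define u w where "u = v a l\<^sub>0" and "w = v b k"
    have ab: "a < 3 * n" "b < 3 * n" "act t a" "act t b" "b < a" "3 * t \<le> b"
      using Suc.prems by (auto simp: a_def b_def act_def)
    have act: "act t i" "i \<noteq> a" "i \<noteq> b" "i < 3 * n" "i < b \<longleftrightarrow> i < 3 * Suc t"
      "i < 3 * Suc t \<Longrightarrow> i < 3 * t \<or> i = 3 * t" "b < i \<or> i < b" "a < i \<or> i < b"
      if "act (Suc t) i" for i
      using that unfolding act_def a_def b_def by presburger+
    have tri: "i < 3 * t \<or> i = 3 * t \<or> 3 * Suc t \<le> i" if "act (Suc t) i" for i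
      using that unfolding act_def by presburger
    have uw: "E' u w" using I2[of b a "l\<^sub>0"] ab l0 sym unfolding u_def w_def by auto
    have u1: "\<not> E' u (v j l)" if "act (Suc t) j" "l < k" for j l
      using I1[of a j l\<^sub>0 l] XX[of a j l\<^sub>0 l] ab act[OF that(1)] that l0 unfolding u_def by auto
    have u2: "E' u (v i k) \<longleftrightarrow> i = 3 * t" if "act (Suc t) i" for i
      using I2[of i a l\<^sub>0] ab act[OF that] l0 sym unfolding u_def a_def b_def by auto
    have w1: "E' w (v j l) = (if b < j then p l else q l)" if "act (Suc t) j" "l < k" for j l
      using I2[of b j l] ab act[OF that(1)] that unfolding w_def by auto
    have w2: "E' w (v i k) = (3 * t \<le> i \<and> e)" if "act (Suc t) i" for i
      using I3[of b i] ab act[OF that] unfolding w_def by auto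
    have neu: "v i l \<noteq> u" "v i l \<noteq> w" if "act (Suc t) i" "l \<le> k" for i l
      using ne[of i a l l\<^sub>0] ne[of i b l k] act[OF that(1)] ab that l0 unfolding u_def w_def by auto
    have piv: "pivot E' u w (v i l) (v j l') = (E' (v i l) (v j l') \<noteq>
        ((E' u (v i l) \<and> E' w (v j l')) \<noteq> (E' w (v i l) \<and> E' u (v j l'))))"
      if "act (Suc t) i" "act (Suc t) j" "l \<le> k" "l' \<le> k" "(i, l) \<noteq> (j, l')" for i j l l'
      using pivot_apply[OF sE' uw] neu ne[of i j l l'] that act by metis
    have self: "\<not> pivot E' u w x x" "\<not> E x x" for x
      using sgraph_pivot[OF sE'] E by (simp_all add: sgraph_def)
    show ?case
    proof (intro exI[of _ "pivot E' u w"] conjI allI impI)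
      show "loc_equiv ?V E (pivot E' u w)"
      proof (rule loc_equiv_trans[OF E' loc_equiv_pivot])
        show "u \<in> ?V" unfolding u_def using ab l0 by (intro rev_image_eqI[of "(a, l\<^sub>0)"]) auto
        show "w \<in> ?V" unfolding w_def using ab by (intro rev_image_eqI[of "(b, k)"]) auto
      qed
      fix i j l l'
      assume *: "act (Suc t) i \<and> act (Suc t) j \<and> l < k \<and> l' < k"
      show "pivot E' u w (v i l) (v j l') = E (v i l) (v j l')"
      proof (cases "(i, l) = (j, l')")
        case False
        then show ?thesis using piv[of i j l l'] u1 I1[of i j l l'] act * by auto
      qed (use self in auto)
    next
      fix i j l
      assume *: "act (Suc t) i \<and> act (Suc t) j \<and> l < k"
      note i = act[of i] and j = act[of j]
      have "pivot E' u w (v i k) (v j l) =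
        (E' (v i k) (v j l) \<noteq> (i = 3 * t \<and> (if b < j then p l else q l)))"
        using piv[of i j k l] u1[of j l] u2[of i] w1[of j l] * by auto
      also have "E' (v i k) (v j l) = (if i < 3 * t then i = j \<and> s l \<noteq> q l
          else if i = j then s l else if i < j then p l else q l)"
        using I2 * i(1) j(1) by blast
      finally show "pivot E' u w (v i k) (v j l) =
        (if i < 3 * Suc t then i = j \<and> s l \<noteq> q l else if i = j then s l else if i < j then p l else q l)"
        using tri[OF conjunct1[OF *]] tri[OF conjunct1[OF conjunct2[OF *]]] i(2,3) j(2,3) *
        by (elim disjE) (simp_all add: a_def b_def)
    next
      fix i j
      assume *: "act (Suc t) i \<and> act (Suc t) j \<and> i \<noteq> j"
      note i = act[of i] and j = act[of j]
      have "pivot E' u w (v i k) (v j k) = ((3 * t \<le> i \<and> 3 * t \<le> j \<and> e) \<noteq>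
        ((i = 3 * t \<and> 3 * t \<le> j \<and> e) \<noteq> (3 * t \<le> i \<and> e \<and> j = 3 * t)))"
        using piv[of i j k k] u2[of i] u2[of j] w2[of i] w2[of j] I3[of i j] i(1) j(1) * by auto
      then show "pivot E' u w (v i k) (v j k) = (3 * Suc t \<le> i \<and> 3 * Suc t \<le> j \<and> e)"
 using tri[OF conjunct1[OF *]] tri[OF conjunct1[OF conjunct2[OF *]]] *
        by (elim disjE) simp_all
    qed
  qed
  from this[of n] obtain E' where E': "loc_equiv ?V E E'"
    and I1: "\<And>i j l l'. act n i \<Longrightarrow> act n j \<Longrightarrow> l < k \<Longrightarrow> l' < k \<Longrightarrow> E' (v i l) (v j l') = E (v i l) (v j l')"
    and I2: "\<And>i j l. act n i \<Longrightarrow> act n j \<Longrightarrow> l < k \<Longrightarrow> E' (v i k) (v j l) =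
        (if i < 3 * n then i = j \<and> s l \<noteq> q l else if i = j then s l else if i < j then p l else q l)"
    and I3: "\<And>i j. act n i \<Longrightarrow> act n j \<Longrightarrow> i \<noteq> j \<Longrightarrow> E' (v i k) (v j k) = (3 * n \<le> i \<and> 3 * n \<le> j \<and> e)"
    by force
  have sym: "E' x y = E' y x" for x y using sgraph_loc_equiv[OF E' E] by (simp add: sgraph_def)
  have act: "act n (3 * i)" if "i < n" for i using that by (simp add: act_def)
  have "\<not> E' (v (3 * i) l) (v (3 * j) l')" if "i < n" "j < n" "i \<noteq> j" "l \<le> k" "l' \<le> k" for i j l l'
  proof -
    have "l < k \<or> l = k" "l' < k \<or> l' = k" using that by auto
    then consider "l < k" "l' < k" | "l = k" "l' < k" | "l < k" "l' = k" | "l = k" "l' = k"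
      by blast
    then show ?thesis
    proof cases
      case 1
      then show ?thesis using I1[OF act act] XX[of "3*i" "3*j" l l'] that by auto
    next
      case 2
      then show ?thesis using I2[OF act act, of i j l'] that by auto
    next
      case 3
      then show ?thesis using I2[OF act act, of j i l] sym[of "v (3 * i) l"] that by simp
    next
      case 4
      then show ?thesis using I3[OF act act, of i j] that by auto
    qed
  qed
  moreover have "E' (v (3 * i) k) (v (3 * i) l) = (s l \<noteq> q l)" if "i < n" "l < k" for i l
    using I2[OF act act, of i i l] that by simp
  moreover have "E' (v (3 * i) l) (v (3 * i) l') = E (v (3 * i) l) (v (3 * i) l')"
    if "i < n" "l < k" "l' < k" for i l l'
    using I1[OF act act, of i i l l'] that by simp
  ultimately show ?thesis using E' by blast
qed

text \<open>The hypotheses of \<open>separate_by_pivots\<close>, with connected pieces.  The extra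
  vertices are pairwise adjacent or pairwise non-adjacent, according to \<open>e\<close>.\<close>

definition homogeneous :: "('a \<Rightarrow> 'a \<Rightarrow> bool) \<Rightarrow> nat \<Rightarrow> (nat \<Rightarrow> nat \<Rightarrow> 'a) \<Rightarrow> nat \<Rightarrow>
    (nat \<Rightarrow> bool) \<Rightarrow> (nat \<Rightarrow> bool) \<Rightarrow> (nat \<Rightarrow> bool) \<Rightarrow> bool \<Rightarrow> bool" where
  "homogeneous E k v N s p q e \<longleftrightarrow>
    inj_on (case_prod v) ({..<N} \<times> {..k}) \<and>
    (\<forall>i<N. conn E (v i ` {..<k})) \<and>
    (\<forall>i<N. \<forall>j<N. i \<noteq> j \<longrightarrow> (\<forall>l<k. \<forall>l'<k. \<not> E (v i l) (v j l'))) \<and>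
    (\<forall>i<N. \<forall>l<k. E (v i k) (v i l) = s l) \<and>
    (\<forall>i j. i < j \<and> j < N \<longrightarrow> (\<forall>l<k. E (v i k) (v j l) = p l \<and> E (v j k) (v i l) = q l) \<and>
      E (v i k) (v j k) = e)"

lemma homogeneousD:
  assumes "homogeneous E k v N s p q e"
  shows "inj_on (case_prod v) ({..<N} \<times> {..k})"
    and "\<And>i. i < N \<Longrightarrow> conn E (v i ` {..<k})"
    and "\<And>i j l l'. i < N \<Longrightarrow> j < N \<Longrightarrow> i \<noteq> j \<Longrightarrow> l < k \<Longrightarrow> l' < k \<Longrightarrow> \<not> E (v i l) (v j l')"
    and "\<And>i l. i < N \<Longrightarrow> l < k \<Longrightarrow> E (v i k) (v i l) = s l"
    and "\<And>i j l. i < j \<Longrightarrow> j < N \<Longrightarrow> l < k \<Longrightarrow> E (v i k) (v j l) = p l"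
    and "\<And>i j l. i < j \<Longrightarrow> j < N \<Longrightarrow> l < k \<Longrightarrow> E (v j k) (v i l) = q l"
    and "\<And>i j. i < j \<Longrightarrow> j < N \<Longrightarrow> E (v i k) (v j k) = e"
  using assms by (simp_all add: homogeneous_def)

lemma homogeneous_pivots:
  assumes E: "sgraph E" and h: "homogeneous E k v N s p q e" "3 * n \<le> N"
    and l0: "l\<^sub>0 < k" "p l\<^sub>0" "\<not> q l\<^sub>0" and l1: "l\<^sub>1 < k" "s l\<^sub>1 \<noteq> q l\<^sub>1"
  shows "has_pieces (case_prod v ` ({..<N} \<times> {..k})) E (k + 1) n"
proof -
  let ?V = "case_prod v ` ({..<3 * n} \<times> {..k})"
  note inj = homogeneousD(1)[OF h(1)] and cn = homogeneousD(2)[OF h(1)]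
  have inj3: "inj_on (case_prod v) ({..<3 * n} \<times> {..k})"
    by (rule inj_on_subset[OF inj]) (use h(2) in auto)
  obtain E' where E': "loc_equiv ?V E E'"
    and sep: "\<And>i j l l'. i < n \<Longrightarrow> j < n \<Longrightarrow> i \<noteq> j \<Longrightarrow> l \<le> k \<Longrightarrow> l' \<le> k \<Longrightarrow> \<not> E' (v (3 * i) l) (v (3 * j) l')"
    and sq: "\<And>i l. i < n \<Longrightarrow> l < k \<Longrightarrow> E' (v (3 * i) k) (v (3 * i) l) = (s l \<noteq> q l)"
    and old: "\<And>i l l'. i < n \<Longrightarrow> l < k \<Longrightarrow> l' < k \<Longrightarrow>
      E' (v (3 * i) l) (v (3 * i) l') = E (v (3 * i) l) (v (3 * i) l')"
    using separate_by_pivots[of E v n k p q e s l\<^sub>0, OF E inj3] homogeneousD(3-7)[OF h(1)] l0 h(2) by force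
  have sym: "E' x y = E' y x" for x y using sgraph_loc_equiv[OF E' E] by (simp add: sgraph_def)
  define v' where "v' i = v (3 * i)" for i
  have inj': "inj_on (case_prod v') ({..<n} \<times> {..k})"
    using inj3 unfolding inj_on_def v'_def by fastforce
  have cn': "conn E' (v' i ` {..k})" if "i < n" for i
  proof -
    have "conn E (v (3 * i) ` {..<k})" using cn that h(2) by simp
    then have "conn E' (v' i ` {..<k})" unfolding v'_def
      by (rule conn_mono) (use old that in auto)
    moreover have "E' (v' i k) (v' i l\<^sub>1)" "E' (v' i l\<^sub>1) (v' i k)" "v' i l\<^sub>1 \<in> v' i ` {..<k}"
      using sq[OF that l1(1)] l1 sym by (auto simp: v'_def)
    moreover have "v' i ` {..k} = insert (v' i k) (v' i ` {..<k})"
      by (auto simp: le_less)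
    ultimately show ?thesis using conn_insert by metis
  qed
  have "pieces E' (k + 1) ((\<lambda>i. v' i ` {..k}) ` {..<n})"
    by (rule pieces_tuples[OF inj']) (use cn' sep in \<open>auto simp: v'_def\<close>)
  moreover have "card ((\<lambda>i. v' i ` {..k}) ` {..<n}) = n"
    using tuples_parts(3)[OF inj'] by simp
  moreover have "\<Union>((\<lambda>i. v' i ` {..k}) ` {..<n}) \<subseteq> ?V"
    by (fastforce simp: v'_def)
  ultimately have "has_pieces ?V E (k + 1) n"
    unfolding has_pieces_def using E' by fastforce
  then show ?thesis
    by (rule has_pieces_mono) (use h(2) in auto)
qed

text \<open>If \<open>s\<close> and \<open>q\<close> agree, separation would leave the extra vertex
  isolated.  Assigning to it the next piece instead of its own makes \<open>p\<close> the new
  pattern \<open>s\<close>.\<close>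

lemma homogeneous_shift:
  assumes h: "homogeneous E k v N s p q e" "Suc M \<le> N" and sq: "\<And>l. l < k \<Longrightarrow> s l = q l"
  defines "v' \<equiv> \<lambda>i l. v (if l < k then Suc i else i) l"
  shows "homogeneous E k v' M p p q e" "case_prod v' ` ({..<M} \<times> {..k}) \<subseteq> case_prod v ` ({..<N} \<times> {..k})"
proof -
  have inj: "inj_on (case_prod v) ({..<N} \<times> {..k})"
    using h(1) unfolding homogeneous_def by blast
  have "inj_on (case_prod v') ({..<M} \<times> {..k})"
  proof (rule inj_onI)
    fix a b assume "a \<in> {..<M} \<times> {..k}" "b \<in> {..<M} \<times> {..k}" "case_prod v' a = case_prod v' b"
    then obtain i l j l' where *: "a = (i, l)" "b = (j, l')" "i < M" "l \<le> k" "j < M" "l' \<le> k"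
      "v' i l = v' j l'" by auto
    have "(if l < k then Suc i else i, l) = (if l' < k then Suc j else j, l')"
      by (rule inj_onD[OF inj]) (use * h(2) in \<open>auto simp: v'_def split: if_splits\<close>)
    then show "a = b" using * by (auto split: if_splits)
  qed
  moreover have v': "v' i ` {..<k} = v (Suc i) ` {..<k}" "v' i k = v i k" for i
    by (auto simp: v'_def)
  moreover have "E (v i k) (v (Suc j) l) = q l" if "j < i" "i < M" "l < k" for i j l
    using that h sq unfolding homogeneous_def by (cases "i = Suc j") auto
  ultimately show "homogeneous E k v' M p p q e"
    using h unfolding homogeneous_def by (auto simp: v'_def)
  show "case_prod v' ` ({..<M} \<times> {..k}) \<subseteq> case_prod v ` ({..<N} \<times> {..k})"
    using h(2) by (force simp: v'_def image_iff)
qed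

text \<open>Reversing the sequence exchanges \<open>p\<close> and \<open>q\<close>, so that pivots
  are available as soon as the two patterns differ.\<close>

lemma homogeneous_rev:
  assumes E: "sgraph E" and h: "homogeneous E k v N s p q e"
  defines "v' \<equiv> \<lambda>i. v (N - Suc i)"
  shows "homogeneous E k v' N s q p e" "case_prod v' ` ({..<N} \<times> {..k}) \<subseteq> case_prod v ` ({..<N} \<times> {..k})"
proof -
  have inj: "inj_on (case_prod v) ({..<N} \<times> {..k})"
    using h unfolding homogeneous_def by blast
  have inj': "inj_on (case_prod v') ({..<N} \<times> {..k})"
  proof (rule inj_onI)
    fix a b assume "a \<in> {..<N} \<times> {..k}" "b \<in> {..<N} \<times> {..k}" "case_prod v' a = case_prod v' b"
    then obtain i l j l' where *: "a = (i, l)" "b = (j, l')" "i < N" "l \<le> k" "j < N" "l' \<le> k"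
      "v' i l = v' j l'" by auto
    have "(N - Suc i, l) = (N - Suc j, l')"
      by (rule inj_onD[OF inj]) (use * in \<open>auto simp: v'_def\<close>)
    then show "a = b" using * by auto
  qed
  have sym: "E x y = E y x" for x y using E by (simp add: sgraph_def)
  have f1: "N - Suc i \<noteq> N - Suc j" if "i \<noteq> j" "i < N" "j < N" for i j
    using that by auto
  have f2: "E (v' i k) (v' j l) = q l" "E (v' j k) (v' i l) = p l" if "i < j" "j < N" "l < k" for i j l
    using that homogeneousD(5,6)[OF h, of "N - Suc j" "N - Suc i" l] by (simp_all add: v'_def)
  have f3: "E (v' i k) (v' j k) = e" if "i < j" "j < N" for i j
    using that homogeneousD(7)[OF h, of "N - Suc j" "N - Suc i"] sym by (simp add: v'_def)
  have f4: "conn E (v' i ` {..<k})" "l < k \<Longrightarrow> E (v' i k) (v' i l) = s l" if "i < N" for i l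
    using that homogeneousD(2,4)[OF h] by (simp_all add: v'_def)
  have f5: "\<not> E (v' i l) (v' j l')" if "i < N" "j < N" "i \<noteq> j" "l < k" "l' < k" for i j l l'
    using that homogeneousD(3)[OF h] f1 by (simp add: v'_def)
  show "homogeneous E k v' N s q p e"
    unfolding homogeneous_def using inj' f2 f3 f4 f5 by simp
  show "case_prod v' ` ({..<N} \<times> {..k}) \<subseteq> case_prod v ` ({..<N} \<times> {..k})"
    by (force simp: v'_def image_iff)
qed

lemma homogeneous_asymmetric:
  assumes E: "sgraph E" and h: "homogeneous E k v N s p q e" "3 * n < N" and l0: "l\<^sub>0 < k" "p l\<^sub>0 \<noteq> q l\<^sub>0"
  shows "has_pieces (case_prod v ` ({..<N} \<times> {..k})) E (k + 1) n"
proof -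
  have *: "has_pieces (case_prod v ` ({..<N} \<times> {..k})) E (k + 1) n"
    if h: "homogeneous E k v N s p q e" and "p l\<^sub>0" "\<not> q l\<^sub>0" for v p q
  proof (cases "\<exists>l<k. s l \<noteq> q l")
    case True
    then show ?thesis using homogeneous_pivots[OF E h, of n l\<^sub>0] assms that by auto
  next
    case False
    have "Suc (3 * n) \<le> N" using assms by simp
    note sh = homogeneous_shift[OF h this]
    have "has_pieces (case_prod (\<lambda>i l. v (if l < k then Suc i else i) l) ` ({..<3 * n} \<times> {..k})) E (k + 1) n"
      by (rule homogeneous_pivots[OF E sh(1), of _ l\<^sub>0 l\<^sub>0]) (use False that l0 in auto)
    then show ?thesis by (rule has_pieces_mono) (use sh(2) False in auto)
  qed
  show ?thesis
  proof (cases "p l\<^sub>0")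
    case True
    then show ?thesis using *[OF h(1)] l0 by simp
  next
    case False
    then show ?thesis
      using has_pieces_mono[OF *[OF homogeneous_rev(1)[OF E h(1)]] homogeneous_rev(2)[OF E h(1)]] l0 by simp
  qed
qed

text \<open>When \<open>y\<^sub>i\<close> sees earlier and later pieces alike, adjacency between
  different tuples depends only on the two positions.  The positions serve as classes of a
  perturbation; removing it turns \<open>s\<close> into \<open>s + p\<close>.\<close>

lemma homogeneous_symmetric:
  assumes E: "sgraph E" and h: "homogeneous E k v N s p p e" "n + 2 * (k + 1) \<le> N"
    and l0: "l\<^sub>0 < k" "s l\<^sub>0 \<noteq> p l\<^sub>0"
  shows "has_pieces (case_prod v ` ({..<N} \<times> {..k})) E (k + 1) n"
proof -
  define V where "V = case_prod v ` ({..<N} \<times> {..k})"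
  define F where "F = (\<lambda>i. v i ` {..k}) ` {..<N}"
  note inj = homogeneousD(1)[OF h(1)] and cn = homogeneousD(2)[OF h(1)] and XX = homogeneousD(3)[OF h(1)]
    and s = homogeneousD(4)[OF h(1)] and p = homogeneousD(5,6)[OF h(1)] and e = homogeneousD(7)[OF h(1)]
  have sym: "E x y = E y x" for x y using E by (simp add: sgraph_def)
  have p': "E (v i k) (v j l) = p l" if "i \<noteq> j" "i < N" "j < N" "l < k" for i j l
    using p[of i j l] p[of j i l] that by (cases i j rule: linorder_cases) auto
  have e': "E (v i k) (v j k) = e" if "i \<noteq> j" "i < N" "j < N" for i j
    using e[of i j] e[of j i] that sym by (cases i j rule: linorder_cases) auto
  have ne: "v i l \<noteq> v j l'" if "i < N" "j < N" "l \<le> k" "l' \<le> k" "(i, l) \<noteq> (j, l')" for i j l l'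
    using inj_onD[OF inj, of "(i, l)" "(j, l')"] that by auto
  define c where "c x = snd (inv_into ({..<N} \<times> {..k}) (case_prod v) x)" for x
  have c: "c (v i l) = l" if "i < N" "l \<le> k" for i l
    using inv_into_f_f[OF inj, of "(i, l)"] that by (simp add: c_def)
  define P where "P l l' = (if l = k then if l' = k then e else p l' else l' = k \<and> p l)" for l l'
  define B where "B x y = (E x y \<noteq> P (c x) (c y))" for x y
  have dF: "disjoint F" and cF: "card F = N"
    using tuples_parts[OF inj] by (simp_all add: F_def)
  have VF: "\<Union>F = V" by (auto simp: V_def F_def image_iff)
  have cV: "c ` V \<subseteq> {..k}" using c by (auto simp: V_def)
  have Pcross: "E x y = P (c x) (c y)" if ij: "i < N" "j < N" "i \<noteq> j" and xy: "x \<in> v i ` {..k}" "y \<in> v j ` {..k}" for i j x y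
  proof -
    from xy obtain l l' where l: "x = v i l" "y = v j l'" "l \<le> k" "l' \<le> k" by auto
    show ?thesis
      using XX[of i j l l'] p'[of i j l'] p'[of j i l] e'[of i j] ij l c sym by (auto simp: P_def le_less)
  qed
  have "\<exists>E' F'. F' \<subseteq> F \<and> card F \<le> card F' + 2 * card (c ` \<Union>F) \<and> loc_equiv (\<Union>F) E E' \<and>
    (\<forall>S\<in>F'. \<forall>T\<in>F'. \<forall>x\<in>S. \<forall>y\<in>T. x \<noteq> y \<longrightarrow> E' x y = (S = T \<and> B x y))"
  proof (rule remove_perturbation[OF _ dF E, where P = P])
    show "finite (c ` \<Union>F)" using cV VF finite_subset by blast
    show "P \<kappa> \<kappa>' = P \<kappa>' \<kappa>" for \<kappa> \<kappa>' by (auto simp: P_def)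
    show "E x y = ((S = T \<and> B x y) \<noteq> P (c x) (c y))"
      if "S \<in> F" "T \<in> F" "x \<in> S" "y \<in> T" for S T x y
    proof (cases "S = T")
      case False
      then obtain i j where "i < N" "j < N" "i \<noteq> j" "S = v i ` {..k}" "T = v j ` {..k}"
        using \<open>S \<in> F\<close> \<open>T \<in> F\<close> unfolding F_def by blast
      then show ?thesis using Pcross[of i j x y] that False by simp
    qed (auto simp: B_def)
  qed (simp add: F_def)
  then obtain E' F' where F': "F' \<subseteq> F" "card F \<le> card F' + 2 * card (c ` V)" "loc_equiv V E E'"
    and E': "\<forall>S\<in>F'. \<forall>T\<in>F'. \<forall>x\<in>S. \<forall>y\<in>T. x \<noteq> y \<longrightarrow> E' x y = (S = T \<and> B x y)"
    unfolding VF by (elim exE conjE) (rule that)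
  have "card (c ` V) \<le> k + 1"
    using card_mono[OF _ cV] by simp
  then have "2 * card (c ` V) \<le> 2 * (k + 1)" by simp
  then have "n + 2 * (k + 1) \<le> card F' + 2 * (k + 1)"
    using F'(2) h(2) unfolding cF by (meson add_left_mono order_trans)
  then have "n \<le> card F'" by simp
  moreover have "pieces E' (k + 1) F'"
    unfolding pieces_def
  proof (intro conjI ballI impI)
    show "disjoint F'" using dF F'(1) by (auto simp: disjoint_def)
    fix S assume "S \<in> F'"
    then obtain i where i: "i < N" "S = v i ` {..k}" using F'(1) by (auto simp: F_def)
    show "card S = k + 1" using tuples_parts(2)[OF inj] i by simp
    have B: "E' (v i l) (v i l') = B (v i l) (v i l')" if "l \<le> k" "l' \<le> k" "l \<noteq> l'" for l l'
      using E' \<open>S \<in> F'\<close> ne[OF i(1) i(1) that(1,2)] that i(2) by auto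
    have "conn E' (v i ` {..<k})"
    proof (rule conn_mono[OF cn[OF i(1)]])
      fix x y assume "x \<in> v i ` {..<k}" "y \<in> v i ` {..<k}" "x \<noteq> y" "E x y"
      moreover from this obtain l l' where "x = v i l" "y = v i l'" "l < k" "l' < k" by blast
      ultimately show "E' x y" using B[of l l'] c[OF i(1), of l] c[OF i(1), of l']
        by (auto simp: B_def P_def)
    qed
    moreover have "E' (v i k) (v i l\<^sub>0)" 
      using B[of k l\<^sub>0] l0 s[OF i(1) l0(1)] c[OF i(1)] by (simp add: B_def P_def)
    moreover have "E' (v i l\<^sub>0) (v i k)" "v i l\<^sub>0 \<in> v i ` {..<k}"
      using calculation sgraph_loc_equiv[OF F'(3) E] l0 by (auto simp: sgraph_def)
    moreover have "S = insert (v i k) (v i ` {..<k})"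
      using i by (auto simp: le_less)
    ultimately show "conn E' S" using conn_insert by metis
  next
    fix S T x y assume *: "S \<in> F'" "T \<in> F'" "S \<noteq> T" "x \<in> S" "y \<in> T"
    have "x \<noteq> y" using dF F'(1) * unfolding disjoint_def by blast
    then show "\<not> E' x y" using E' * by blast
  qed
  moreover have "\<Union>F' \<subseteq> V" using F'(1) VF by blast
  ultimately show ?thesis
    unfolding has_pieces_def V_def[symmetric] using F'(3) by blast
qed

lemma homogeneous_has_pieces:
  assumes "sgraph E" "homogeneous E k v (3 * n + 2 * k + 3) s p q e"
    and "l\<^sub>0 < k" "\<not> (s l\<^sub>0 = p l\<^sub>0 \<and> p l\<^sub>0 = q l\<^sub>0)"
  shows "has_pieces (case_prod v ` ({..<3 * n + 2 * k + 3} \<times> {..k})) E (k + 1) n"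
proof (cases "\<exists>l<k. p l \<noteq> q l")
  case True
  then show ?thesis using homogeneous_asymmetric[OF assms(1,2), of n] by auto
next
  case False
  then have "homogeneous E k v (3 * n + 2 * k + 3) s p p e"
    using assms(2) unfolding homogeneous_def by simp
  then show ?thesis
    using homogeneous_symmetric[OF assms(1), of k v _ s p e n l\<^sub>0] False assms(3,4) by auto
qed

section \<open>Matrices with many distinct rows\<close>

lemma card_le_two_power:
  assumes "finite B" "inj_on (\<lambda>x. {y \<in> B. M x y}) A"
  shows "card A \<le> 2 ^ card B"
proof -
  have "card A = card ((\<lambda>x. {y \<in> B. M x y}) ` A)" using assms(2) by (simp add: card_image)
  also have "\<dots> \<le> card (Pow B)" using assms(1) by (intro card_mono) auto
  finally show ?thesis using assms(1) by (simp add: card_Pow)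
qed

text \<open>The result is a large matching, co-matching or half graph between rows and columns: the
  diagonal differs from one of the two constants above and below it.

  Take a minimal set of columns that separates all rows.  It is large, and minimality provides for
  each of its columns two rows that differ in this column only.  Ramsey's theorem makes the entries
  off the diagonal constant above and below it.  If both constants agree, one of the two rows has
  the other value on the diagonal.  If not, every second index is dropped, so that the column of a
  dropped index distinguishes the rows on its two sides.\<close>

lemma skew_sequence:
  fixes n :: nat
  shows "\<exists>D. \<forall>(M :: 'a \<Rightarrow> 'b \<Rightarrow> bool) A Y. finite Y \<and> inj_on (\<lambda>x. {y \<in> Y. M x y}) A \<and> D \<le> card A \<longrightarrow>
    (\<exists>x y \<alpha> \<beta>. (\<forall>i<n. x i \<in> A \<and> y i \<in> Y \<and> \<not> (M (x i) (y i) = \<alpha> \<and> \<alpha> = \<beta>)) \<and>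
      inj_on x {..<n} \<and> inj_on y {..<n} \<and>
      (\<forall>i j. i < j \<and> j < n \<longrightarrow> M (x i) (y j) = \<alpha> \<and> M (x j) (y i) = \<beta>))"
proof -
  obtain N :: nat where N: "\<And>f :: nat \<Rightarrow> nat \<Rightarrow> bool \<times> bool.
    \<exists>\<sigma> c. (\<forall>i j. i < j \<and> j < 2 * n \<longrightarrow> \<sigma> i < \<sigma> j \<and> f (\<sigma> i) (\<sigma> j) = c) \<and> (\<forall>i<2*n. \<sigma> i < N)"
    using ramsey_pairs[of "UNIV :: (bool \<times> bool) set" "2 * n"] by auto
  show ?thesis
  proof (intro exI[of _ "2 ^ N"] allI impI, elim conjE)
    fix M :: "'a \<Rightarrow> 'b \<Rightarrow> bool" and A Y
    assume Y: "finite Y" and inj: "inj_on (\<lambda>x. {y \<in> Y. M x y}) A" and A: "2 ^ N \<le> card A"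
    let ?sep = "\<lambda>B. B \<subseteq> Y \<and> inj_on (\<lambda>x. {y \<in> B. M x y}) A"
    obtain B where B: "?sep B" and min: "\<And>C. ?sep C \<Longrightarrow> card B \<le> card C"
      using ex_has_least_nat[of ?sep Y card] inj by auto
    have finB: "finite B" using B Y finite_subset by blast
    have "2 ^ N \<le> (2::nat) ^ card B" using card_le_two_power[OF finB conjunct2[OF B]] A by linarith
    then have cB: "N \<le> card B" by simp
    obtain h where h: "bij_betw h {..<card B} B"
      using finB by (metis ex_bij_betw_nat_finite atLeast0LessThan)
    have hB: "h i \<in> B" if "i < N" for i using h that cB by (auto simp: bij_betw_def)
    have hinj: "h i = h j \<longleftrightarrow> i = j" if "i < N" "j < N" for i j
      using h that cB by (auto simp: bij_betw_def inj_on_def)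
    have "\<exists>a a'. a \<in> A \<and> a' \<in> A \<and> M a (h i) \<noteq> M a' (h i) \<and> (\<forall>y\<in>B. y \<noteq> h i \<longrightarrow> M a y = M a' y)"
      if i: "i < N" for i
    proof -
      have "card (B - {h i}) < card B" using finB hB[OF i] by (rule card_Diff1_less)
      then have "\<not> ?sep (B - {h i})" using min[of "B - {h i}"] by linarith
      then have "\<not> inj_on (\<lambda>x. {y \<in> B - {h i}. M x y}) A" using B by blast
      then obtain a a' where a: "a \<in> A" "a' \<in> A" "a \<noteq> a'"
        "{y \<in> B - {h i}. M a y} = {y \<in> B - {h i}. M a' y}"
        unfolding inj_on_def by blast
      have "{y \<in> B. M a y} \<noteq> {y \<in> B. M a' y}" using B a unfolding inj_on_def by blast
      then show ?thesis using a by blast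
    qed
    then obtain a a' where a: "\<And>i. i < N \<Longrightarrow> a i \<in> A" "\<And>i. i < N \<Longrightarrow> a' i \<in> A"
      "\<And>i. i < N \<Longrightarrow> M (a i) (h i) \<noteq> M (a' i) (h i)"
      "\<And>i y. i < N \<Longrightarrow> y \<in> B \<Longrightarrow> y \<noteq> h i \<Longrightarrow> M (a i) y = M (a' i) y"
      by metis
    obtain \<sigma> \<alpha>\<beta> where \<sigma>\<sigma>: "\<forall>i j. i < j \<and> j < 2 * n \<longrightarrow> \<sigma> i < \<sigma> j \<and>
        (M (a (\<sigma> i)) (h (\<sigma> j)), M (a (\<sigma> j)) (h (\<sigma> i))) = \<alpha>\<beta>" and "\<forall>i<2 * n. \<sigma> i < N"
      using N[of "\<lambda>i j. (M (a i) (h j), M (a j) (h i))"] by blast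
    define \<alpha> \<beta> where "\<alpha> = fst \<alpha>\<beta>" and "\<beta> = snd \<alpha>\<beta>"
    have \<sigma>: "\<And>i j. i < j \<Longrightarrow> j < 2 * n \<Longrightarrow> \<sigma> i < \<sigma> j" "\<And>i. i < 2 * n \<Longrightarrow> \<sigma> i < N"
      using \<sigma>\<sigma> \<open>\<forall>i<2 * n. \<sigma> i < N\<close> by simp_all
    have \<alpha>: "\<And>i j. i < j \<Longrightarrow> j < 2 * n \<Longrightarrow> M (a (\<sigma> i)) (h (\<sigma> j)) = \<alpha>"
      and \<beta>: "\<And>i j. i < j \<Longrightarrow> j < 2 * n \<Longrightarrow> M (a (\<sigma> j)) (h (\<sigma> i)) = \<beta>"
      using \<sigma>\<sigma> unfolding \<alpha>_def \<beta>_def by (metis fst_conv, metis snd_conv)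
    have \<sigma>inj: "\<sigma> i = \<sigma> j \<longleftrightarrow> i = j" if "i < 2 * n" "j < 2 * n" for i j
      using \<sigma>(1)[of i j] \<sigma>(1)[of j i] that by (cases i j rule: linorder_cases) auto
    show "\<exists>x y \<alpha> \<beta>. (\<forall>i<n. x i \<in> A \<and> y i \<in> Y \<and> \<not> (M (x i) (y i) = \<alpha> \<and> \<alpha> = \<beta>)) \<and>
      inj_on x {..<n} \<and> inj_on y {..<n} \<and>
      (\<forall>i j. i < j \<and> j < n \<longrightarrow> M (x i) (y j) = \<alpha> \<and> M (x j) (y i) = \<beta>)"
    proof (cases "\<alpha> = \<beta>")
      case True
      define x where "x i = (if M (a (\<sigma> i)) (h (\<sigma> i)) = \<alpha> then a' (\<sigma> i) else a (\<sigma> i))" for i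
      have xA: "x i \<in> A" and xi: "M (x i) (h (\<sigma> i)) \<noteq> \<alpha>" if "i < n" for i
        using a \<sigma>(2)[of i] that unfolding x_def by auto
      have xj: "M (x i) (h (\<sigma> j)) = \<alpha>" if "i < n" "j < n" "i \<noteq> j" for i j
      proof -
        have ij: "i < 2 * n" "j < 2 * n" using that by auto
        have "h (\<sigma> j) \<noteq> h (\<sigma> i)" using hinj \<sigma>(2) \<sigma>inj ij that(3) by blast
        then have "M (x i) (h (\<sigma> j)) = M (a (\<sigma> i)) (h (\<sigma> j))"
          using a(4)[of "\<sigma> i" "h (\<sigma> j)"] hB \<sigma>(2) ij unfolding x_def by auto
        then show ?thesis using \<alpha>[of i j] \<beta>[of j i] ij that(3) True by (cases i j rule: linorder_cases) auto
      qed
      show ?thesis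
      proof (intro exI conjI allI impI)
        show "inj_on x {..<n}" using xi xj by (auto simp: inj_on_def) metis
        show "inj_on (\<lambda>i. h (\<sigma> i)) {..<n}" using hinj \<sigma>(2) \<sigma>inj by (auto simp: inj_on_def)
        show "\<not> (M (x i) (h (\<sigma> i)) = \<alpha> \<and> \<alpha> = \<beta>)" if "i < n" for i using xi that by blast
        show "h (\<sigma> i) \<in> Y" if "i < n" for i using hB[of "\<sigma> i"] \<sigma>(2)[of i] B that by auto
      qed (use xA xj True in auto)
    next
      case False
      have sep: "M (a (\<sigma> (2 * i))) (h (\<sigma> (2 * i + 1))) \<noteq> M (a (\<sigma> (2 * j))) (h (\<sigma> (2 * i + 1)))"
        if "i < j" "j < n" for i j
        using \<alpha>[of "2 * i" "2 * i + 1"] \<beta>[of "2 * i + 1" "2 * j"] that False by auto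
      show ?thesis
      proof (intro exI conjI allI impI)
        show "inj_on (\<lambda>i. a (\<sigma> (2 * i))) {..<n}"
        proof (rule inj_onI, rule ccontr)
          fix i j assume "i \<in> {..<n}" "j \<in> {..<n}" "a (\<sigma> (2 * i)) = a (\<sigma> (2 * j))" "i \<noteq> j"
          then show False using sep[of i j] sep[of j i] by (cases i j rule: linorder_cases) auto
        qed
        show "inj_on (\<lambda>i. h (\<sigma> (2 * i))) {..<n}" using hinj \<sigma>(2) \<sigma>inj by (auto simp: inj_on_def)
        show "h (\<sigma> (2 * i)) \<in> Y" if "i < n" for i using hB[of "\<sigma> (2 * i)"] \<sigma>(2)[of "2 * i"] B that by auto
        show "a (\<sigma> (2 * i)) \<in> A" if "i < n" for i using a(1) \<sigma>(2) that by simp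
        show "\<not> (M (a (\<sigma> (2 * i))) (h (\<sigma> (2 * i))) = \<alpha> \<and> \<alpha> = \<beta>)" for i using False by simp
        show "M (a (\<sigma> (2 * i))) (h (\<sigma> (2 * j))) = \<alpha>" "M (a (\<sigma> (2 * j))) (h (\<sigma> (2 * i))) = \<beta>"
          if "i < j \<and> j < n" for i j
          using \<alpha>[of "2 * i" "2 * j"] \<beta>[of "2 * i" "2 * j"] that by auto
      qed
    qed
  qed
qed

section \<open>Adding a vertex to each piece\<close>

lemma finite_Union_pieces: "pieces E k F \<Longrightarrow> finite V \<Longrightarrow> \<Union>F \<subseteq> V \<Longrightarrow> finite F"
  by (meson finite_UnionD finite_subset)

text \<open>A piece has at most \<open>k\<close> rows, so a proportion \<open>1/k\<close> of the
  distinct rows can be found in distinct pieces.\<close>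

lemma distinct_rows_transversal:
  assumes "finite F" "\<And>S. S \<in> F \<Longrightarrow> finite S \<and> card S \<le> k"
  obtains A \<pi> where "A \<subseteq> \<Union>F" "inj_on r A" "inj_on \<pi> A" "\<forall>x\<in>A. \<pi> x \<in> F \<and> x \<in> \<pi> x"
    "card (r ` \<Union>F) \<le> k * card A"
proof -
  have "\<forall>x\<in>\<Union>F. \<exists>S. S \<in> F \<and> x \<in> S" by blast
  then obtain \<pi> where \<pi>: "\<And>x. x \<in> \<Union>F \<Longrightarrow> \<pi> x \<in> F \<and> x \<in> \<pi> x" by metis
  obtain A0 where A0: "A0 \<subseteq> \<Union>F" "inj_on r A0" "r ` \<Union>F = r ` A0"
    using subset_image_inj[of "r ` \<Union>F" r "\<Union>F"] by auto
  obtain A where A: "A \<subseteq> A0" "inj_on \<pi> A" "\<pi> ` A0 = \<pi> ` A"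
    using subset_image_inj[of "\<pi> ` A0" \<pi> A0] by auto
  have mem: "S \<in> F" if "S \<in> \<pi> ` A" for S
  proof -
    from that obtain x where "x \<in> A" "S = \<pi> x" by blast
    then show ?thesis using \<pi>[of x] A(1) A0(1) by blast
  qed
  have fin: "finite (\<pi> ` A)" by (rule finite_subset[OF _ assms(1)]) (use mem in auto)
  have "A0 \<subseteq> \<Union>(\<pi> ` A)"
  proof
    fix x assume "x \<in> A0"
    then have "\<pi> x \<in> \<pi> ` A" "x \<in> \<pi> x" using \<pi>[of x] A0(1) A(3) by blast+
    then show "x \<in> \<Union>(\<pi> ` A)" by blast
  qed
  then have "card A0 \<le> card (\<Union>(\<pi> ` A))"
    using fin assms(2) mem by (intro card_mono) auto
  also have "\<dots> \<le> sum card (\<pi> ` A)"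
    using fin mem assms(2) by (intro card_Union_le_sum_card) 
  also have "\<dots> \<le> card (\<pi> ` A) * k"
    using sum_bounded_above[of "\<pi> ` A" card k] mem assms(2) by simp
  finally have "card (r ` \<Union>F) \<le> k * card A"
    using A0 A(2) by (simp add: card_image mult.commute)
  moreover have "A \<subseteq> \<Union>F" using A(1) A0(1) by (rule order_trans)
  moreover from this have "\<pi> x \<in> F \<and> x \<in> \<pi> x" if "x \<in> A" for x using \<pi>[of x] that by blast
  ultimately show ?thesis using that[of A \<pi>] A(2) inj_on_subset[OF A0(2) A(1)] by simp
qed

text \<open>The skew sequence \<open>x\<^sub>i\<close>, \<open>y\<^sub>i\<close> is completed to
  tuples by the piece of \<open>x\<^sub>i\<close>.  A second use of Ramsey's theorem makes the
  tuples homogeneous; the colour of \<open>i < j\<close> records all adjacencies between the two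
  tuples, together with the pattern of \<open>y\<^sub>i\<close> on its own piece and the position of
  \<open>x\<^sub>i\<close>.  At this position the patterns \<open>s\<close>, \<open>p\<close> and
  \<open>q\<close> are not all equal.\<close>

lemma extend_pieces:
  fixes k n :: nat
  assumes k: "k \<ge> 1"
  shows "\<exists>D. \<forall>(E :: 'a \<Rightarrow> 'a \<Rightarrow> bool) F V Y. finite V \<and> sgraph E \<and> pieces E k F \<and> \<Union>F \<subseteq> V \<and>
    Y \<subseteq> V - \<Union>F \<and> D \<le> card ((\<lambda>x. {y \<in> Y. E x y}) ` \<Union>F) \<longrightarrow> has_pieces V E (k + 1) n"
proof -
  \<comment> \<open>Ramsey's theorem is used with \<open>Suc N1\<close> tuples, because the colour of a pair describes the inside of its
    smaller member only.\<close>
  define N1 where "N1 = 3 * n + 2 * k + 3"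
  let ?C = "Pow ({..k} \<times> {..k}) \<times> Pow {..<k} \<times> {..<k}"
  obtain N2 :: nat where N2: "\<And>f :: nat \<Rightarrow> nat \<Rightarrow> (nat \<times> nat) set \<times> nat set \<times> nat.
    \<forall>i j. i < j \<and> j < N2 \<longrightarrow> f i j \<in> ?C \<Longrightarrow>
    \<exists>\<sigma> c. (\<forall>i j. i < j \<and> j < Suc N1 \<longrightarrow> \<sigma> i < \<sigma> j \<and> f (\<sigma> i) (\<sigma> j) = c) \<and> (\<forall>i<Suc N1. \<sigma> i < N2)"
    using ramsey_pairs[of ?C "Suc N1"] by auto
  obtain D where D: "\<forall>(M :: 'a \<Rightarrow> 'a \<Rightarrow> bool) A Y.
    finite Y \<and> inj_on (\<lambda>x. {y \<in> Y. M x y}) A \<and> D \<le> card A \<longrightarrow>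
    (\<exists>x y \<alpha> \<beta>. (\<forall>i<N2. x i \<in> A \<and> y i \<in> Y \<and> \<not> (M (x i) (y i) = \<alpha> \<and> \<alpha> = \<beta>)) \<and>
      inj_on x {..<N2} \<and> inj_on y {..<N2} \<and>
      (\<forall>i j. i < j \<and> j < N2 \<longrightarrow> M (x i) (y j) = \<alpha> \<and> M (x j) (y i) = \<beta>))"
    using skew_sequence[of N2] by (elim exE) (rule that)
  show ?thesis
  proof (intro exI[of _ "k * D"] allI impI, elim conjE)
    fix E :: "'a \<Rightarrow> 'a \<Rightarrow> bool" and F V Y
    assume V: "finite V" and E: "sgraph E" and F: "pieces E k F" and FV: "\<Union>F \<subseteq> V"
      and Y: "Y \<subseteq> V - \<Union>F" and many: "k * D \<le> card ((\<lambda>x. {y \<in> Y. E x y}) ` \<Union>F)"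
    have sym: "E x y = E y x" for x y using E by (simp add: sgraph_def)
    have finF: "finite F" using finite_Union_pieces[OF F V FV] .
    have cardS: "finite S \<and> card S = k" if "S \<in> F" for S
      using F that k by (metis pieces_def card.infinite not_one_le_zero)
    have cardS': "finite S \<and> card S \<le> k" if "S \<in> F" for S using cardS[OF that] by simp
    obtain A \<pi> where A: "A \<subseteq> \<Union>F" "inj_on (\<lambda>x. {y \<in> Y. E x y}) A" "inj_on \<pi> A"
      and \<pi>: "\<forall>x\<in>A. \<pi> x \<in> F \<and> x \<in> \<pi> x"
      and A4: "card ((\<lambda>x. {y \<in> Y. E x y}) ` \<Union>F) \<le> k * card A"
      by (rule distinct_rows_transversal[OF finF cardS', where r = "\<lambda>x. {y \<in> Y. E x y}"])
    have "k * D \<le> k * card A" using many A4 by (rule order_trans)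
    then have "D \<le> card A" using k by simp
    moreover have "finite Y" using Y V finite_subset by blast
    ultimately obtain x y \<alpha> \<beta> where xy: "\<forall>i<N2. x i \<in> A \<and> y i \<in> Y \<and> \<not> (E (x i) (y i) = \<alpha> \<and> \<alpha> = \<beta>)"
      and xinj: "inj_on x {..<N2}" and yinj: "inj_on y {..<N2}"
      and skew: "\<forall>i j. i < j \<and> j < N2 \<longrightarrow> E (x i) (y j) = \<alpha> \<and> E (x j) (y i) = \<beta>"
      using D[rule_format, of Y E A] A(2) by blast
    have "\<forall>S. \<exists>g. S \<in> F \<longrightarrow> bij_betw g {..<k} S"
      using cardS by (metis ex_bij_betw_nat_finite atLeast0LessThan)
    then obtain g where g: "\<And>S. S \<in> F \<Longrightarrow> bij_betw (g S) {..<k} S" by metis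
    have "\<forall>i. \<exists>l. i < N2 \<longrightarrow> l < k \<and> g (\<pi> (x i)) l = x i"
      using g \<pi> xy by (metis bij_betw_imp_surj_on image_iff lessThan_iff)
    then obtain lab where lab: "\<And>i. i < N2 \<Longrightarrow> lab i < k \<and> g (\<pi> (x i)) (lab i) = x i" by metis
    define v where "v i l = (if l < k then g (\<pi> (x i)) l else y i)" for i l
    define f where "f i j = ({(l, l'). l \<le> k \<and> l' \<le> k \<and> E (v i l) (v j l')},
      {l. l < k \<and> E (v i k) (v i l)}, lab i)" for i j
    have "\<forall>i j. i < j \<and> j < N2 \<longrightarrow> f i j \<in> ?C" using lab by (auto simp: f_def)
    then obtain \<sigma> c where \<sigma>f: "\<forall>i j. i < j \<and> j < Suc N1 \<longrightarrow> \<sigma> i < \<sigma> j \<and> f (\<sigma> i) (\<sigma> j) = c"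
      and \<sigma>N: "\<And>i. i < Suc N1 \<Longrightarrow> \<sigma> i < N2"
      using N2[of f] by blast
    have \<sigma>lt: "\<sigma> i < \<sigma> j" if "i < j" "j < Suc N1" for i j using \<sigma>f that by blast
    have \<sigma>inj: "\<sigma> i = \<sigma> j \<longleftrightarrow> i = j" if "i < Suc N1" "j < Suc N1" for i j
      using \<sigma>lt[of i j] \<sigma>lt[of j i] that by (cases i j rule: linorder_cases) auto
    obtain Q s l\<^sub>0 where c: "c = (Q, s, l\<^sub>0)" by (cases c)
    define w where "w i = v (\<sigma> i)" for i
    have cross: "E (w i l) (w j l') \<longleftrightarrow> (l, l') \<in> Q" if "i < j" "j < Suc N1" "l \<le> k" "l' \<le> k" for i j l l'
      using \<sigma>f that c by (auto simp: f_def w_def)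
    have within: "E (w i k) (w i l) \<longleftrightarrow> l \<in> s" "lab (\<sigma> i) = l\<^sub>0" if "i < N1" "l < k" for i l
    proof -
      have "f (\<sigma> i) (\<sigma> N1) = (Q, s, l\<^sub>0)" using \<sigma>f that(1) c by simp
      then show "E (w i k) (w i l) \<longleftrightarrow> l \<in> s" "lab (\<sigma> i) = l\<^sub>0"
        using that(2) by (auto simp: f_def w_def)
    qed
    define S where "S i = \<pi> (x (\<sigma> i))" for i
    have S: "S i \<in> F" "x (\<sigma> i) \<in> A" "y (\<sigma> i) \<in> Y" if "i < N1" for i
      using \<pi> xy \<sigma>N[of i] that by (auto simp: S_def)
    have Sinj: "S i \<noteq> S j" if "i < N1" "j < N1" "i \<noteq> j" for i j
    proof -
      have "x (\<sigma> i) \<noteq> x (\<sigma> j)"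
        using xinj \<sigma>N[of i] \<sigma>N[of j] \<sigma>inj[of i j] that by (auto simp: inj_on_def)
      then show ?thesis using A(3) S(2)[OF that(1)] S(2)[OF that(2)] by (auto simp: S_def inj_on_def)
    qed
    have wk: "w i k = y (\<sigma> i)" for i by (simp add: w_def v_def)
    have wS: "w i ` {..<k} = S i" if "i < N1" for i
      using g[OF S(1)[OF that]] by (auto simp: w_def v_def S_def bij_betw_def image_iff)
    have wSl: "w i l \<in> S i" if "i < N1" "l < k" for i l using wS[OF that(1)] that(2) by blast
    have YS: "y' \<notin> T" if "T \<in> F" "y' \<in> Y" for T y' using Y that by blast
    have disj: "S i \<inter> S j = {}" if "i < N1" "j < N1" "i \<noteq> j" for i j
      using F S(1) Sinj that unfolding pieces_def disjoint_def by meson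
    have "homogeneous E k w N1 (\<lambda>l. l \<in> s) (\<lambda>l. (k, l) \<in> Q) (\<lambda>l. (l, k) \<in> Q) ((k, k) \<in> Q)"
      unfolding homogeneous_def
    proof (intro conjI allI impI)
      show "inj_on (case_prod w) ({..<N1} \<times> {..k})"
      proof (rule inj_onI)
        fix a b assume "a \<in> {..<N1} \<times> {..k}" "b \<in> {..<N1} \<times> {..k}" "case_prod w a = case_prod w b"
        then obtain i l j l' where ab: "a = (i, l)" "b = (j, l')" "i < N1" "l \<le> k" "j < N1" "l' \<le> k"
          and eq: "w i l = w j l'" by auto
        show "a = b"
        proof (cases "l = k \<or> l' = k")
          case True
          then have "l = k \<and> l' = k"
            using eq wk wSl[of i l] wSl[of j l'] YS S(1,3) ab by (metis le_neq_implies_less)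
          moreover from this have "y (\<sigma> i) = y (\<sigma> j)" using eq wk by simp
          then have "i = j"
            using yinj \<sigma>N[of i] \<sigma>N[of j] \<sigma>inj[of i j] ab by (auto simp: inj_on_def)
          ultimately show ?thesis using ab by simp
        next
          case False
          then have l: "l < k" "l' < k" using ab by auto
          have "i = j" using disj[OF ab(3,5)] wSl[OF ab(3) l(1)] wSl[OF ab(5) l(2)] eq by auto
          moreover have "l = l'"
            using eq l g[OF S(1)[OF ab(3)]] \<open>i = j\<close>
            by (auto simp: w_def v_def S_def bij_betw_def inj_on_def)
          ultimately show ?thesis using ab by simp
        qed
      qed
      show "conn E (w i ` {..<k})" if "i < N1" for i
        using wS[OF that] S(1)[OF that] F by (simp add: pieces_def)
      show "\<not> E (w i l) (w j l')" if "i < N1" "j < N1" "i \<noteq> j" "l < k" "l' < k" for i j l l'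
        using F S(1) Sinj[OF that(1-3)] wSl that unfolding pieces_def by meson
      show "E (w i k) (w i l) = (l \<in> s)" if "i < N1" "l < k" for i l
        using within(1) that by blast
      fix i j assume ij: "i < j \<and> j < N1"
      show "E (w i k) (w j l) = ((k, l) \<in> Q)" if "l < k" for l using cross[of i j k l] ij that by simp
      show "E (w j k) (w i l) = ((l, k) \<in> Q)" if "l < k" for l
        using cross[of i j l k] ij that sym by simp
      show "E (w i k) (w j k) = ((k, k) \<in> Q)" using cross[of i j k k] ij by simp
    qed
    moreover have l0: "l\<^sub>0 < k"
      using within(2)[of 0 0] lab[of "\<sigma> 0"] \<sigma>N[of 0] k by (auto simp: N1_def)
    moreover have w0: "w i l\<^sub>0 = x (\<sigma> i)" if "i < N1" for i
    proof -
      have "lab (\<sigma> i) = l\<^sub>0" using within(2)[of i 0] that k by simp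
      then show ?thesis using lab[of "\<sigma> i"] \<sigma>N[of i] that l0 by (auto simp: w_def v_def)
    qed
    moreover have "\<not> ((l\<^sub>0 \<in> s) = ((k, l\<^sub>0) \<in> Q) \<and> ((k, l\<^sub>0) \<in> Q) = ((l\<^sub>0, k) \<in> Q))"
    proof -
      have N: "0 < N1" "1 < N1" by (simp_all add: N1_def)
      have "(l\<^sub>0 \<in> s) = E (x (\<sigma> 0)) (y (\<sigma> 0))" using within(1)[OF N(1) l0] w0[OF N(1)] wk sym by simp
      moreover have "((k, l\<^sub>0) \<in> Q) = E (x (\<sigma> 1)) (y (\<sigma> 0))"
        using cross[of 0 1 k l\<^sub>0] l0 N w0[OF N(2)] wk sym by simp
      moreover have "((l\<^sub>0, k) \<in> Q) = E (x (\<sigma> 0)) (y (\<sigma> 1))"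
        using cross[of 0 1 l\<^sub>0 k] l0 N w0[OF N(1)] wk sym by simp
      moreover have "\<sigma> 0 < \<sigma> 1" "\<sigma> 1 < N2" using \<sigma>lt[of 0 1] \<sigma>N[of 1] N by simp_all
      ultimately show ?thesis using skew xy by (metis order_less_trans)
    qed
    ultimately have "has_pieces (case_prod w ` ({..<N1} \<times> {..k})) E (k + 1) n"
      using homogeneous_has_pieces[OF E, of k w n] unfolding N1_def by blast
    moreover have "w i l \<in> V" if "i < N1" "l \<le> k" for i l
    proof (cases "l = k")
      case True
      then show ?thesis using wk S(3)[OF that(1)] Y by auto
    next
      case False
      then show ?thesis using wSl[OF that(1), of l] S(1)[OF that(1)] that FV by auto
    qed
    ultimately show "has_pieces V E (k + 1) n"
      by (elim has_pieces_mono) auto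
  qed
qed

section \<open>Cut-rank of adjacency relations\<close>

interpretation fun_space: vector_space "\<lambda>(c::bit) (v::'b \<Rightarrow> bit) b. c * v b"
  by (rule vector_space_fun)

definition row :: "('a \<Rightarrow> 'a \<Rightarrow> bool) \<Rightarrow> 'a set \<Rightarrow> 'a \<Rightarrow> 'a \<Rightarrow> bit" where
  "row E T a = (\<lambda>b. if b \<in> T \<and> E a b then 1 else 0)"

definition cutrank :: "('a \<Rightarrow> 'a \<Rightarrow> bool) \<Rightarrow> 'a set \<Rightarrow> 'a set \<Rightarrow> nat" where
  "cutrank E V S = fun_space.dim (row E (V - S) ` S)"

text \<open>Brittleness at most \<open>N\<close>, as a property that is also meaningful on subsets
  of the vertex set.\<close>

definition narrow :: "('a \<Rightarrow> 'a \<Rightarrow> bool) \<Rightarrow> 'a set \<Rightarrow> nat \<Rightarrow> nat \<Rightarrow> bool" where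
  "narrow E V k N \<longleftrightarrow>
    (\<exists>P. partition_on V P \<and> (\<forall>S\<in>P. card S \<le> k) \<and> (\<forall>I\<subseteq>P. cutrank E V (\<Union>I) \<le> N))"

lemma dim_le_dim_if_subset_span:
  fixes W :: "('b \<Rightarrow> bit) set"
  assumes "finite W" "U \<subseteq> fun_space.span W"
  shows "fun_space.dim U \<le> fun_space.dim W"
proof -
  obtain B where B: "B \<subseteq> W" "fun_space.independent B" "W \<subseteq> fun_space.span B" "card B = fun_space.dim W"
    by (rule fun_space.basis_exists)
  then have "U \<subseteq> fun_space.span B"
    using assms(2) fun_space.span_minimal[OF _ fun_space.subspace_span, of W B] by blast
  then show ?thesis
    using fun_space.dim_le_card[of U B] B assms(1) finite_subset by fastforce
qed

lemma dim_image_le: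
  fixes \<phi> :: "('b \<Rightarrow> bit) \<Rightarrow> 'c \<Rightarrow> bit"
  assumes "finite W" "\<And>u v. \<phi> (u + v) = \<phi> u + \<phi> v" "\<And>c v. \<phi> (\<lambda>b. c * v b) = (\<lambda>b. c * \<phi> v b)"
  shows "fun_space.dim (\<phi> ` W) \<le> fun_space.dim W"
proof -
  interpret \<phi>: module_hom "\<lambda>(c::bit) (v::'b \<Rightarrow> bit) b. c * v b" "\<lambda>(c::bit) (v::'c \<Rightarrow> bit) b. c * v b" \<phi>
    by unfold_locales (use assms(2,3) in auto)
  obtain B where B: "B \<subseteq> W" "fun_space.independent B" "W \<subseteq> fun_space.span B" "card B = fun_space.dim W"
    by (rule fun_space.basis_exists)
  then have "\<phi> ` W \<subseteq> fun_space.span (\<phi> ` B)" using \<phi>.span_image by blast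
  moreover have "finite B" using B assms(1) finite_subset by blast
  ultimately show ?thesis
    using fun_space.dim_le_card[of "\<phi> ` W" "\<phi> ` B"] card_image_le[of B \<phi>] B by auto
qed

text \<open>If \<open>v \<in> S\<close>, local complementation at \<open>v\<close> adds the row of
  \<open>v\<close> to the rows of its neighbours.  If \<open>v \<notin> S\<close>, it adds the
  column of \<open>v\<close> to the columns of its neighbours, which is the linear map
  \<open>\<phi>\<close> on rows.\<close>

lemma cutrank_lc:
  assumes E: "sgraph E" and V: "finite V" and v: "v \<in> V" and S: "S \<subseteq> V"
  shows "cutrank (lc E v) V S \<le> cutrank E V S"
proof -
  have fin: "finite (row E (V - S) ` S)" using V S finite_subset by blast
  have sym: "E x y = E y x" "\<not> E x x" for x y using E by (simp_all add: sgraph_def)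
  show ?thesis
  proof (cases "v \<in> S")
    case True
    have "row (lc E v) (V - S) a \<in> fun_space.span (row E (V - S) ` S)" if "a \<in> S" for a
    proof -
      have "row (lc E v) (V - S) a =
          row E (V - S) a + (if E v a then row E (V - S) v else 0)"
        using that by (auto simp: row_def lc_def fun_eq_iff)
      moreover have span: "row E (V - S) x \<in> fun_space.span (row E (V - S) ` S)" if "x \<in> S" for x
        by (rule fun_space.span_base) (use that in blast)
      ultimately show ?thesis
        using fun_space.span_add[OF span[OF that] span[OF True]] span[OF that]
        by (cases "E v a") (simp_all only: if_True if_False add_0_right)
    qed
    then show ?thesis
      unfolding cutrank_def by (intro dim_le_dim_if_subset_span fin) auto
  next
    case False
    define \<phi> :: "('a \<Rightarrow> bit) \<Rightarrow> 'a \<Rightarrow> bit"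
      where "\<phi> u = (\<lambda>b. u b + (if b \<in> V - S \<and> E v b then u v else 0))" for u
    have "row (lc E v) (V - S) a = \<phi> (row E (V - S) a)" if "a \<in> S" for a
      using that False v sym by (auto simp: row_def lc_def \<phi>_def fun_eq_iff)
    then have "row (lc E v) (V - S) ` S = \<phi> ` row E (V - S) ` S" by (auto simp: image_iff)
    moreover have "\<phi> (u + w) = \<phi> u + \<phi> w" for u w
      unfolding \<phi>_def by (rule ext) (simp only: plus_fun_apply split: if_split, simp only: ac_simps add_0_left add_0_right, blast)
    moreover have "\<phi> (\<lambda>b. c * u b) = (\<lambda>b. c * \<phi> u b)" for c u
    proof
      fix b show "\<phi> (\<lambda>b. c * u b) b = c * \<phi> u b"
        unfolding \<phi>_def by (cases "b \<in> V - S \<and> E v b")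
          (simp_all only: simp_thms if_True if_False distrib_left mult_zero_right)
    qed
    ultimately show ?thesis
      unfolding cutrank_def using dim_image_le[OF fin, of \<phi>] by metis
  qed
qed

lemma narrow_loc_equiv:
  assumes "loc_equiv V E E'" "sgraph E" "finite V" "narrow E' V k N"
  shows "narrow E V k N"
proof -
  have "loc_equiv V E' E" by (rule loc_equiv_sym[OF assms(1,2)])
  have E': "sgraph E'" by (rule sgraph_loc_equiv[OF assms(1,2)])
  from \<open>loc_equiv V E' E\<close> have le: "cutrank E V S \<le> cutrank E' V S" if "S \<subseteq> V" for S
  proof (induction rule: loc_equiv_induct)
    case (step E'' v)
    have "sgraph E''" by (rule sgraph_loc_equiv[OF _ E']) (fact step)
    moreover have "v \<in> V" "cutrank E'' V S \<le> cutrank E' V S" by (fact step)+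
    ultimately show ?case using cutrank_lc[OF _ assms(3) _ that, of E'' v] by linarith
  qed simp
  obtain P where P: "partition_on V P" "\<forall>S\<in>P. card S \<le> k" "\<forall>I\<subseteq>P. cutrank E' V (\<Union>I) \<le> N"
    using assms(4) unfolding narrow_def by blast
  have "cutrank E V (\<Union>I) \<le> N" if "I \<subseteq> P" for I
  proof -
    have "\<Union>I \<subseteq> V" using P(1) that by (auto simp: partition_on_def)
    then show ?thesis using le[of "\<Union>I"] P(3) that order_trans by blast
  qed
  then show ?thesis using P unfolding narrow_def by blast
qed

text \<open>The pieces are added as further parts.  In the matrix of a union of parts, the pieces
  have rank 0 among themselves and the rest has rank at most \<open>N\<close>.  Of the two mixed
  blocks, the one with rows in the pieces has at most \<open>D\<close> distinct rows.  A row of the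
  other block is determined by the set of neighbourhood classes that its vertex is adjacent to,
  which gives at most \<open>2 ^ D\<close> rows.\<close>

lemma narrow_extend:
  assumes E: "sgraph E" and V: "finite V" and F: "pieces E k F" and FV: "\<Union>F \<subseteq> V"
    and D: "card ((\<lambda>x. {y \<in> V - \<Union>F. E x y}) ` \<Union>F) \<le> D"
    and narrow: "narrow E (V - \<Union>F) k N"
  shows "narrow E V k (N + (D + 2 ^ D))"
proof -
  define X Y where "X = \<Union>F" and "Y = V - X"
  define r where "r x = {y \<in> Y. E x y}" for x
  have sym: "E x y = E y x" for x y using E by (simp add: sgraph_def)
  have finX: "finite X" "finite Y" using V FV finite_subset by (auto simp: X_def Y_def)
  have rD: "card (r ` X) \<le> D" using D by (simp add: r_def[abs_def] X_def Y_def)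
  obtain P where P: "partition_on Y P" "\<forall>S\<in>P. card S \<le> k" "\<forall>I\<subseteq>P. cutrank E Y (\<Union>I) \<le> N"
    using narrow unfolding narrow_def X_def Y_def by blast
  have "partition_on V (F \<union> P)"
  proof (rule partition_onI)
    show "\<Union>(F \<union> P) = V" using P(1) FV by (auto simp: partition_on_def X_def Y_def)
    show "{} \<notin> F \<union> P" using P(1) F by (auto simp: partition_on_def pieces_def conn_def)
    fix p q assume pq: "p \<in> F \<union> P" "q \<in> F \<union> P" "p \<noteq> q"
    have mixed: "S \<inter> T = {}" if "S \<in> F" "T \<in> P" for S T
      using P(1) that by (auto simp: partition_on_def X_def Y_def)
    have "disjoint F" "disjoint P" using P(1) F by (simp_all add: partition_on_def pieces_def)
    then have "p \<inter> q = {}"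
      using pq mixed[of p q] mixed[of q p] by (auto dest: disjointD)
    then show "disjnt p q" by (simp add: disjnt_def)
  qed
  moreover have "cutrank E V (\<Union>I) \<le> N + (D + 2 ^ D)" if I: "I \<subseteq> F \<union> P" for I
  proof -
    define S1 S2 where "S1 = \<Union>(I \<inter> F)" and "S2 = \<Union>(I \<inter> P)"
    have S: "\<Union>I = S1 \<union> S2" using I by (auto simp: S1_def S2_def)
    have S1: "S1 \<subseteq> X" by (auto simp: S1_def X_def)
    have S2: "S2 \<subseteq> Y" using P(1) by (auto simp: S2_def partition_on_def)
    have compl: "V - \<Union>I = (X - S1) \<union> (Y - S2)" "X \<inter> Y = {}"
      using S S1 S2 FV by (auto simp: X_def Y_def)
    have none: "\<not> E a b" if "a \<in> S1" "b \<in> X - S1" for a b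
    proof -
      from that obtain p q where pq: "p \<in> I" "p \<in> F" "a \<in> p" "q \<in> F" "b \<in> q" "q \<notin> I"
        by (auto simp: S1_def X_def)
      then have "p \<noteq> q" by blast
      then show ?thesis using F pq unfolding pieces_def by blast
    qed
    define W1 where "W1 = row E (Y - S2) ` S1"
    define W2 where "W2 = row E (X - S1) ` S2"
    obtain B where B: "B \<subseteq> row E (Y - S2) ` S2" "fun_space.independent B" "row E (Y - S2) ` S2 \<subseteq> fun_space.span B"
      "card B = fun_space.dim (row E (Y - S2) ` S2)"
      by (rule fun_space.basis_exists)
    have finS: "finite S1" "finite S2" using finX S1 S2 finite_subset by blast+
    have finB: "finite B" using B(1) finS finite_subset by blast
    have B': "card B \<le> N" using P(3) B(4) by (auto simp: cutrank_def S2_def)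
    have "W1 = (\<lambda>R b. if b \<in> Y - S2 \<and> b \<in> R then 1 else 0) ` r ` S1"
      by (auto simp: W1_def row_def r_def image_image intro!: image_cong)
    then have "card W1 \<le> card (r ` S1)" using finS by (simp add: card_image_le)
    also have "\<dots> \<le> D" using rD S1 finX by (meson card_mono finite_imageI image_mono order_trans)
    finally have W1: "card W1 \<le> D" .
    have "W2 \<subseteq> (\<lambda>C b. if b \<in> X - S1 \<and> r b \<in> C then 1 else 0) ` Pow (r ` X)"
    proof
      fix u assume "u \<in> W2"
      then obtain a where a: "a \<in> S2" "u = row E (X - S1) a" by (auto simp: W2_def)
      have "a \<in> Y" using a S2 by blast
      then have "u = (\<lambda>b. if b \<in> X - S1 \<and> r b \<in> {R \<in> r ` X. a \<in> R} then 1 else 0)"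
        using a sym by (auto simp: row_def r_def fun_eq_iff)
      then show "u \<in> (\<lambda>C b. if b \<in> X - S1 \<and> r b \<in> C then 1 else 0) ` Pow (r ` X)" by blast
    qed
    then have "card W2 \<le> card (Pow (r ` X))" using finX by (simp add: surj_card_le)
    also have "\<dots> = 2 ^ card (r ` X)" using finX by (simp add: card_Pow)
    also have "\<dots> \<le> 2 ^ D" using rD by simp
    finally have W2: "card W2 \<le> 2 ^ D" .
    let ?U = "W1 \<union> W2 \<union> B"
    have "row E (V - \<Union>I) a \<in> fun_space.span ?U" if "a \<in> S1 \<union> S2" for a
    proof (cases "a \<in> S1")
      case True
      have "row E (V - \<Union>I) a = row E (Y - S2) a"
        using none[OF True] compl by (auto simp: row_def fun_eq_iff)
      moreover have "row E (Y - S2) a \<in> ?U" using True by (simp add: W1_def)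
      ultimately show ?thesis using fun_space.span_base by metis
    next
      case False
      then have a: "a \<in> S2" using that by blast
      have "row E (V - \<Union>I) a = row E (X - S1) a + row E (Y - S2) a"
        using compl by (auto simp: row_def fun_eq_iff)
      moreover have "row E (X - S1) a \<in> fun_space.span ?U"
        by (rule fun_space.span_base) (use a in \<open>simp add: W2_def\<close>)
      moreover have "row E (Y - S2) a \<in> fun_space.span ?U"
        using a B(3) fun_space.span_mono[of B ?U] by blast
      ultimately show ?thesis using fun_space.span_add by simp
    qed
    then have "cutrank E V (\<Union>I) \<le> card ?U"
      unfolding cutrank_def S using finS finB
      by (intro fun_space.dim_le_card) (auto simp: W1_def W2_def)
    also have "\<dots> \<le> card W1 + card W2 + card B"
      using card_Un_le[of "W1 \<union> W2" B] card_Un_le[of W1 W2] by linarith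
    finally show ?thesis using W1 W2 B' by linarith
  qed
  moreover have "card S \<le> k" if "S \<in> F \<union> P" for S using that P(2) F by (auto simp: pieces_def)
  ultimately show ?thesis unfolding narrow_def by blast
qed

section \<open>Large brittleness gives many pieces\<close>

text \<open>Local complementation at \<open>v \<in> Y\<close> treats two vertices of
  \<open>X\<close> with the same neighbours in \<open>Y\<close> alike, and this persists, because
  such vertices still have the same neighbours in \<open>Y\<close> afterwards.\<close>

lemma loc_equiv_outside:
  assumes "loc_equiv Y E E'" "sgraph E" "X \<inter> Y = {}"
  defines "r \<equiv> \<lambda>x. {y \<in> Y. E x y}"
  shows "\<exists>P R. (\<forall>\<kappa> \<kappa>'. P \<kappa> \<kappa>' \<longleftrightarrow> P \<kappa>' \<kappa>) \<and>
    (\<forall>x\<in>X. \<forall>x'\<in>X. x \<noteq> x' \<longrightarrow> E' x x' = (E x x' \<noteq> P (r x) (r x'))) \<and>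
    (\<forall>x\<in>X. \<forall>y\<in>Y. E' x y = (y \<in> R (r x)))"
  using assms(1)
proof (induction rule: loc_equiv_induct)
  case refl
  show ?case
    by (intro exI[of _ "\<lambda>_ _. False"] exI[of _ "\<lambda>S. S"]) (auto simp: r_def)
next
  case (step E' v)
  then obtain P R where P: "\<forall>\<kappa> \<kappa>'. P \<kappa> \<kappa>' \<longleftrightarrow> P \<kappa>' \<kappa>"
    and PX: "\<forall>x\<in>X. \<forall>x'\<in>X. x \<noteq> x' \<longrightarrow> E' x x' = (E x x' \<noteq> P (r x) (r x'))"
    and R: "\<forall>x\<in>X. \<forall>y\<in>Y. E' x y = (y \<in> R (r x))" by blast
  have v: "v \<in> Y" by (fact step)
  have "sgraph E'" by (rule sgraph_loc_equiv[OF _ assms(2)]) (fact step)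
  then have sym: "E' x y = E' y x" for x y by (simp add: sgraph_def)
  have Ev: "E' v x = (v \<in> R (r x))" if "x \<in> X" for x using R that v sym by blast
  show ?case
  proof (intro exI conjI)
    show "\<forall>\<kappa> \<kappa>'. (P \<kappa> \<kappa>' \<noteq> (v \<in> R \<kappa> \<and> v \<in> R \<kappa>')) = (P \<kappa>' \<kappa> \<noteq> (v \<in> R \<kappa>' \<and> v \<in> R \<kappa>))"
      using P by blast
    show "\<forall>x\<in>X. \<forall>x'\<in>X. x \<noteq> x' \<longrightarrow>
      lc E' v x x' = (E x x' \<noteq> (P (r x) (r x') \<noteq> (v \<in> R (r x) \<and> v \<in> R (r x'))))"
      using PX Ev by (auto simp: lc_def)
    show "\<forall>x\<in>X. \<forall>y\<in>Y. lc E' v x y = (y \<in> {y. (y \<in> R (r x)) \<noteq> (v \<in> R (r x) \<and> E' v y)})"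
      using R Ev assms(3) by (auto simp: lc_def)
  qed
qed

text \<open>On the union of the old pieces (\<open>F\<close>, taken from \<open>E\<close>) and the
  new ones (\<open>F2\<close>, created by local complementations in \<open>Y\<close>),
  \<open>E2\<close> is a perturbation of the disjoint union.  A class is a neighbourhood in
  \<open>Y\<close> for vertices of old pieces, and the set of classes of adjacent old vertices for
  vertices of new pieces.  So there are at most \<open>D + 2 ^ D\<close> classes.\<close>

lemma merge_pieces:
  assumes E: "sgraph E" and F: "pieces E k F"
    and F2: "loc_equiv Y E E2" "pieces E2 k F2" "\<Union>F2 \<subseteq> Y" and Y: "\<Union>F \<inter> Y = {}"
    and fin: "finite (\<Union>F)" "finite Y" and D: "card ((\<lambda>x. {y \<in> Y. E x y}) ` \<Union>F) \<le> D"
  shows "\<exists>E3 F3. loc_equiv (\<Union>F \<union> Y) E E3 \<and> pieces E3 k F3 \<and> \<Union>F3 \<subseteq> \<Union>F \<union> Y \<and>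
    card F + card F2 \<le> card F3 + 2 * (D + 2 ^ D)"
proof -
  define X where "X = \<Union>F"
  define r where "r x = {y \<in> Y. E x y}" for x
  have XY: "X \<inter> Y = {}" using Y by (simp add: X_def)
  have rD: "card (r ` X) \<le> D" using D by (simp add: r_def[abs_def] X_def)
  have E2: "sgraph E2" by (rule sgraph_loc_equiv[OF F2(1) E])
  then have sym: "E2 x y = E2 y x" for x y by (simp add: sgraph_def)
  obtain P R where P: "\<forall>\<kappa> \<kappa>'. P \<kappa> \<kappa>' \<longleftrightarrow> P \<kappa>' \<kappa>"
    and PX: "\<forall>x\<in>X. \<forall>x'\<in>X. x \<noteq> x' \<longrightarrow> E2 x x' = (E x x' \<noteq> P (r x) (r x'))"
    and R: "\<forall>x\<in>X. \<forall>y\<in>Y. E2 x y = (y \<in> R (r x))"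
    using loc_equiv_outside[OF F2(1) E XY, folded r_def] by (elim exE conjE) (rule that)
  define c where "c x = (if x \<in> X then Inl (r x) else Inr {r u | u. u \<in> X \<and> E2 u x})" for x
  define P' where "P' \<kappa> \<kappa>' = (case (\<kappa>, \<kappa>') of (Inl \<rho>, Inl \<rho>') \<Rightarrow> P \<rho> \<rho>' | (Inl \<rho>, Inr \<Gamma>) \<Rightarrow> \<rho> \<in> \<Gamma>
    | (Inr \<Gamma>, Inl \<rho>) \<Rightarrow> \<rho> \<in> \<Gamma> | (Inr _, Inr _) \<Rightarrow> False)" for \<kappa> \<kappa>' :: "'a set + 'a set set"
  define B where "B x y = (if x \<in> X then E x y else E2 x y)" for x y
  let ?F = "F \<union> F2"
  have in_X: "S \<subseteq> X" if "S \<in> F" for S using that by (auto simp: X_def)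
  have in_Y: "S \<subseteq> Y" if "S \<in> F2" for S using that F2(3) by blast
  have nonempty: "S \<noteq> {}" if "S \<in> ?F" for S using that F F2(2) by (auto simp: pieces_def conn_def)
  have dis12: "F \<inter> F2 = {}"
  proof (rule ccontr)
    assume "F \<inter> F2 \<noteq> {}"
    then obtain S where "S \<in> F" "S \<in> F2" by blast
    then show False using in_X[of S] in_Y[of S] nonempty[of S] XY by auto
  qed
  have dF: "disjoint ?F"
  proof (rule disjointI)
    fix S T assume ST: "S \<in> ?F" "T \<in> ?F" "S \<noteq> T"
    have "disjoint F" "disjoint F2" using F F2(2) by (simp_all add: pieces_def)
    then have same: "S \<in> F \<Longrightarrow> T \<in> F \<Longrightarrow> S \<inter> T = {}" "S \<in> F2 \<Longrightarrow> T \<in> F2 \<Longrightarrow> S \<inter> T = {}"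
      using ST(3) by (auto dest: disjointD)
    have mixed: "S' \<inter> T' = {}" if "S' \<in> F" "T' \<in> F2" for S' T'
      using in_X[OF that(1)] in_Y[OF that(2)] XY by blast
    show "S \<inter> T = {}" using ST(1,2) same mixed[of S T] mixed[of T S] by auto
  qed
  have UF: "\<Union>?F \<subseteq> X \<union> Y" using F2(3) by (auto simp: X_def)
  have finU: "finite (\<Union>?F)" using finite_subset[OF UF] fin by (simp add: X_def)
  then have finF: "finite ?F" by (rule finite_UnionD)
  have EX: "E x y = (S = T \<and> E x y)" if "S \<in> F" "T \<in> F" "x \<in> S" "y \<in> T" for S T x y
    using F that unfolding pieces_def by blast
  have EY: "E2 x y = (S = T \<and> E2 x y)" if "S \<in> F2" "T \<in> F2" "x \<in> S" "y \<in> T" for S T x y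
    using F2(2) that unfolding pieces_def by blast
  have cross: "E2 x y = (r x \<in> {r u | u. u \<in> X \<and> E2 u y})" if "x \<in> X" "y \<in> Y" for x y
    using R that by auto
  have "\<exists>E' F'. F' \<subseteq> ?F \<and> card ?F \<le> card F' + 2 * card (c ` \<Union>?F) \<and> loc_equiv (\<Union>?F) E2 E' \<and>
    (\<forall>S\<in>F'. \<forall>T\<in>F'. \<forall>x\<in>S. \<forall>y\<in>T. x \<noteq> y \<longrightarrow> E' x y = (S = T \<and> B x y))"
  proof (rule remove_perturbation[OF finF dF E2 finite_imageI[OF finU], where P = P'])
    show "P' \<kappa> \<kappa>' = P' \<kappa>' \<kappa>" for \<kappa> \<kappa>'
      using P by (auto simp: P'_def split: sum.splits)
    fix S T x y assume ST: "S \<in> ?F" "T \<in> ?F" and xy: "x \<in> S" "y \<in> T" "x \<noteq> y"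
    consider "S \<in> F" "T \<in> F" | "S \<in> F" "T \<in> F2" | "S \<in> F2" "T \<in> F" | "S \<in> F2" "T \<in> F2"
      using ST by blast
    then show "E2 x y = ((S = T \<and> B x y) \<noteq> P' (c x) (c y))"
    proof cases
      case 1
      then have "x \<in> X" "y \<in> X" using in_X xy by blast+
      then show ?thesis using bspec[OF bspec[OF PX], of x y] EX[OF 1 xy(1,2)] xy by (auto simp: B_def P'_def c_def)
    next
      case 2
      then have "x \<in> X" "y \<in> Y" "y \<notin> X" "S \<noteq> T" using in_X in_Y xy XY by blast+
      moreover from this have "E2 x y = P' (c x) (c y)"
        unfolding cross[OF \<open>x \<in> X\<close> \<open>y \<in> Y\<close>] by (simp add: P'_def c_def)
      ultimately show ?thesis by simp
    next
      case 3
      then have "y \<in> X" "x \<in> Y" "x \<notin> X" "S \<noteq> T" using in_X in_Y xy XY by blast+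
      moreover from this have "E2 y x = P' (c x) (c y)"
        unfolding cross[OF \<open>y \<in> X\<close> \<open>x \<in> Y\<close>] by (simp add: P'_def c_def)
      ultimately show ?thesis using sym[of x y] by simp
    next
      case 4
      then have "x \<notin> X" "y \<notin> X" using in_Y xy XY by blast+
      then show ?thesis using EY[OF 4 xy(1,2)] by (simp add: P'_def c_def B_def)
    qed
  qed
  then obtain E3 F3 where F3: "F3 \<subseteq> ?F" "card ?F \<le> card F3 + 2 * card (c ` \<Union>?F)" "loc_equiv (\<Union>?F) E2 E3"
    and E3: "\<forall>S\<in>F3. \<forall>T\<in>F3. \<forall>x\<in>S. \<forall>y\<in>T. x \<noteq> y \<longrightarrow> E3 x y = (S = T \<and> B x y)"
    by (elim exE conjE) (rule that)
  have finr: "finite (r ` X)" using fin by (simp add: X_def)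
  have "c ` \<Union>?F \<subseteq> Inl ` r ` X \<union> Inr ` Pow (r ` X)"
    by (auto simp: c_def)
  then have "card (c ` \<Union>?F) \<le> card (Inl ` r ` X \<union> Inr ` Pow (r ` X) :: ('a set + 'a set set) set)"
    using finr by (intro card_mono) auto
  also have "\<dots> \<le> card (r ` X) + 2 ^ card (r ` X)"
    by (rule order_trans[OF card_Un_le]) (use finr in \<open>simp add: card_image card_Pow\<close>)
  also have "\<dots> \<le> D + 2 ^ D" using rD by (intro add_mono) auto
  finally have "2 * card (c ` \<Union>?F) \<le> 2 * (D + 2 ^ D)" by (rule mult_le_mono2)
  then have "card ?F \<le> card F3 + 2 * (D + 2 ^ D)"
    by (rule order_trans[OF F3(2) add_left_mono])
  moreover have "card ?F = card F + card F2" using dis12 finF by (simp add: card_Un_disjoint)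
  ultimately have "card F + card F2 \<le> card F3 + 2 * (D + 2 ^ D)" by simp
  moreover have "pieces E3 k F3"
    unfolding pieces_def
  proof (intro conjI ballI impI)
    show "disjoint F3" using dF F3(1) by (auto simp: disjoint_def)
    fix S assume S: "S \<in> F3"
    then have "S \<in> F \<or> S \<in> F2" using F3(1) by blast
    then show "card S = k" using F F2(2) by (auto simp: pieces_def)
    from \<open>S \<in> F \<or> S \<in> F2\<close> show "conn E3 S"
    proof
      assume "S \<in> F"
      then have "conn E S" "S \<subseteq> X" using F in_X by (auto simp: pieces_def)
      then show ?thesis by (elim conn_mono) (use E3 S in \<open>auto simp: B_def\<close>)
    next
      assume "S \<in> F2"
      then have "conn E2 S" "S \<inter> X = {}" using F2(2) in_Y XY by (auto simp: pieces_def)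
      then show ?thesis by (elim conn_mono) (use E3 S in \<open>auto simp: B_def\<close>)
    qed
  next
    fix S T x y assume *: "S \<in> F3" "T \<in> F3" "S \<noteq> T" "x \<in> S" "y \<in> T"
    then have "x \<noteq> y" using disjointD[OF dF, of S T] F3(1) by blast
    then show "\<not> E3 x y" using E3 * by blast
  qed
  moreover have "loc_equiv (X \<union> Y) E E3"
    by (rule loc_equiv_trans[OF loc_equiv_mono[OF F2(1)] loc_equiv_mono[OF F3(3) UF]]) simp
  moreover have "\<Union>F3 \<subseteq> X \<union> Y" using F3(1) UF by blast
  ultimately show ?thesis unfolding X_def by blast
qed

text \<open>Consider a graph locally equivalent to \<open>E\<close> with as many
  \<open>k\<close>-pieces as possible, and the rest \<open>Y\<close> of the vertices.  If there are
  no \<open>m\<close> larger pieces, there are few neighbourhoods in \<open>Y\<close> by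
  \<open>extend_pieces\<close>.  Hence \<open>Y\<close> still has large brittleness and acquires
  more new pieces than \<open>merge_pieces\<close> loses, against maximality.\<close>

lemma enlarge_pieces:
  fixes k m :: nat
  assumes k: "k \<ge> 1"
    and IH: "\<And>m. \<exists>N. \<forall>(E :: 'a \<Rightarrow> 'a \<Rightarrow> bool) V. finite V \<and> sgraph E \<and> \<not> narrow E V k N \<longrightarrow> has_pieces V E k m"
  shows "\<exists>N. \<forall>(E :: 'a \<Rightarrow> 'a \<Rightarrow> bool) V. finite V \<and> sgraph E \<and> \<not> narrow E V k N \<longrightarrow> has_pieces V E (k + 1) m"
proof -
  obtain D where D: "\<forall>(E :: 'a \<Rightarrow> 'a \<Rightarrow> bool) F V Y. finite V \<and> sgraph E \<and> pieces E k F \<and> \<Union>F \<subseteq> V \<and>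
    Y \<subseteq> V - \<Union>F \<and> D \<le> card ((\<lambda>x. {y \<in> Y. E x y}) ` \<Union>F) \<longrightarrow> has_pieces V E (k + 1) m"
    using extend_pieces[OF k, of m] by (elim exE) (rule that)
  obtain N where N: "\<forall>(E :: 'a \<Rightarrow> 'a \<Rightarrow> bool) V. finite V \<and> sgraph E \<and> \<not> narrow E V k N \<longrightarrow>
      has_pieces V E k (2 * (D + 2 ^ D) + 1)"
    using IH[of "2 * (D + 2 ^ D) + 1"] by (elim exE) (rule that)
  show ?thesis
  proof (intro exI[of _ "N + (D + 2 ^ D)"] allI impI, elim conjE, rule ccontr)
    fix E :: "'a \<Rightarrow> 'a \<Rightarrow> bool" and V
    assume V: "finite V" and E: "sgraph E" and wide: "\<not> narrow E V k (N + (D + 2 ^ D))"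
      and none: "\<not> has_pieces V E (k + 1) m"
    define Q where "Q c \<longleftrightarrow> (\<exists>E' F. loc_equiv V E E' \<and> pieces E' k F \<and> \<Union>F \<subseteq> V \<and> card F = c)" for c
    have "Q 0" unfolding Q_def
      by (intro exI[of _ E] exI[of _ "{}"]) (auto simp: loc_equiv_refl pieces_def)
    moreover have "c \<le> card (Pow V)" if "Q c" for c
      using that V unfolding Q_def by (auto intro!: card_mono)
    ultimately have "\<exists>c. Q c \<and> (\<forall>c'. Q c' \<longrightarrow> c' \<le> c)"
      by (intro ex_has_greatest_nat[of Q 0 "\<lambda>c. c" "Suc (card (Pow V))"]) (auto simp: le_imp_less_Suc)
    then obtain c where c: "Q c" and max: "\<forall>c'. Q c' \<longrightarrow> c' \<le> c"
      by (elim exE conjE) (rule that)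
    from c obtain E1 F where E1: "loc_equiv V E E1" and F: "pieces E1 k F" "\<Union>F \<subseteq> V" "card F = c"
      unfolding Q_def by blast
    define Y where "Y = V - \<Union>F"
    have sE1: "sgraph E1" by (rule sgraph_loc_equiv[OF E1 E])
    have fin: "finite (\<Union>F)" "finite Y" using V F(2) finite_subset by (auto simp: Y_def)
    have few: "card ((\<lambda>x. {y \<in> Y. E1 x y}) ` \<Union>F) \<le> D"
    proof (rule ccontr)
      assume "\<not> ?thesis"
      then have "has_pieces V E1 (k + 1) m"
        using D[rule_format, of V E1 F Y] V sE1 F by (simp add: Y_def)
      then show False using none has_pieces_loc_equiv[OF E1] by blast
    qed
    have "\<not> narrow E1 V k (N + (D + 2 ^ D))"
      using wide narrow_loc_equiv[OF E1 E V] by blast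
    then have "\<not> narrow E1 Y k N"
      using narrow_extend[OF sE1 V F(1,2), of D N] few by (auto simp: Y_def)
    then have "has_pieces Y E1 k (2 * (D + 2 ^ D) + 1)" using N fin(2) sE1 by blast
    then obtain E2 F2 where F2: "loc_equiv Y E1 E2" "pieces E2 k F2" "\<Union>F2 \<subseteq> Y"
      and card2: "2 * (D + 2 ^ D) + 1 \<le> card F2"
      unfolding has_pieces_def by blast
    have VY: "\<Union>F \<union> Y = V" "\<Union>F \<inter> Y = {}" using F(2) by (auto simp: Y_def)
    obtain E3 F3 where "loc_equiv V E1 E3" "pieces E3 k F3" "\<Union>F3 \<subseteq> V"
      and card3: "card F + card F2 \<le> card F3 + 2 * (D + 2 ^ D)"
      using merge_pieces[OF sE1 F(1) F2 VY(2) fin few] unfolding VY(1) by blast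
    then have "Q (card F3)" unfolding Q_def using loc_equiv_trans[OF E1] by blast
    then show False using max card2 card3 F(3) by fastforce
  qed
qed

lemma narrow_card:
  assumes "finite V"
  shows "narrow E V 1 (card V)"
  unfolding narrow_def
proof (intro exI conjI allI impI)
  show "partition_on V ((\<lambda>x. {x}) ` V)"
    by (auto simp: partition_on_def disjoint_def)
  show "\<forall>S\<in>(\<lambda>x. {x}) ` V. card S \<le> 1" by simp
  fix I assume "I \<subseteq> (\<lambda>x. {x}) ` V"
  then have sub: "\<Union>I \<subseteq> V" by blast
  then have fin: "finite (\<Union>I)" using assms finite_subset by blast
  have "cutrank E V (\<Union>I) \<le> card (row E (V - \<Union>I) ` \<Union>I)"
    unfolding cutrank_def by (intro fun_space.dim_le_card fun_space.span_superset finite_imageI fin)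
  also have "\<dots> \<le> card (\<Union>I)" by (rule card_image_le[OF fin])
  also have "\<dots> \<le> card V" by (rule card_mono[OF assms sub])
  finally show "cutrank E V (\<Union>I) \<le> card V" .
qed

text \<open>The start of the induction.  The partition into singletons shows that a graph of large
  brittleness has many vertices, hence a large clique or independent set by Ramsey's theorem.  A
  clique or independent set, with singletons as pieces, is a perturbation of the edgeless graph with
  a single class.\<close>

lemma independent_set:
  fixes m :: nat
  shows "\<exists>N. \<forall>(E :: 'a \<Rightarrow> 'a \<Rightarrow> bool) V. finite V \<and> sgraph E \<and> \<not> narrow E V 1 N \<longrightarrow> has_pieces V E 1 m"
proof -
  obtain N :: nat where N: "\<And>f :: nat \<Rightarrow> nat \<Rightarrow> bool.
    \<exists>\<sigma> c. (\<forall>i j. i < j \<and> j < m + 2 \<longrightarrow> \<sigma> i < \<sigma> j \<and> f (\<sigma> i) (\<sigma> j) = c) \<and> (\<forall>i<m+2. \<sigma> i < N)"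
    using ramsey_pairs[of "UNIV :: bool set" "m + 2"] by auto
  show ?thesis
  proof (intro exI[of _ N] allI impI, elim conjE)
    fix E :: "'a \<Rightarrow> 'a \<Rightarrow> bool" and V
    assume V: "finite V" and E: "sgraph E" and wide: "\<not> narrow E V 1 N"
    have sym: "E x y = E y x" for x y using E by (simp add: sgraph_def)
    have "N \<le> card V"
    proof (rule ccontr)
      assume "\<not> N \<le> card V"
      moreover obtain P where "partition_on V P" "\<forall>S\<in>P. card S \<le> 1" "\<forall>I\<subseteq>P. cutrank E V (\<Union>I) \<le> card V"
        using narrow_card[OF V, of E] unfolding narrow_def by blast
      ultimately show False using wide unfolding narrow_def by (meson linear order_trans)
    qed
    obtain h where h: "bij_betw h {..<card V} V"
      using V by (metis ex_bij_betw_nat_finite atLeast0LessThan)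
    obtain \<sigma> b where \<sigma>b: "\<forall>i j. i < j \<and> j < m + 2 \<longrightarrow> \<sigma> i < \<sigma> j \<and> E (h (\<sigma> i)) (h (\<sigma> j)) = b"
      and \<sigma>N: "\<forall>i<m+2. \<sigma> i < N"
      using N[of "\<lambda>i j. E (h i) (h j)"] by (elim exE conjE) (rule that)
    define w where "w i = h (\<sigma> i)" for i
    have wV: "w i \<in> V" if "i < m + 2" for i
    proof -
      have "\<sigma> i < card V" using \<sigma>N that \<open>N \<le> card V\<close> by (meson order_less_le_trans)
      then show ?thesis using h by (auto simp: w_def bij_betw_def)
    qed
    have winj: "inj_on w {..<m + 2}"
    proof (rule inj_onI, rule ccontr)
      fix i j assume ij: "i \<in> {..<m + 2}" "j \<in> {..<m + 2}" "w i = w j" "i \<noteq> j"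
      then have "\<sigma> i \<noteq> \<sigma> j" using \<sigma>b by (metis lessThan_iff less_irrefl linorder_neqE_nat)
      moreover have "\<sigma> i < card V" "\<sigma> j < card V" using \<sigma>N ij \<open>N \<le> card V\<close> by auto
      ultimately show False using ij(3) h by (auto simp: w_def bij_betw_def inj_on_def)
    qed
    have wE: "E (w i) (w j) = b" if "i < m + 2" "j < m + 2" "i \<noteq> j" for i j
      using \<sigma>b sym that unfolding w_def by (metis linorder_neqE_nat)
    define F where "F = (\<lambda>i. {w i}) ` {..<m + 2}"
    have cF: "card F = m + 2"
      unfolding F_def using winj by (subst card_image) (auto simp: inj_on_def)
    have FV: "\<Union>F \<subseteq> V" using wV by (auto simp: F_def)
    define c where "c x = ()" for x :: 'a
    have "c ` \<Union>F \<subseteq> {()}" by auto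
    then have cc: "card (c ` \<Union>F) \<le> 1" using card_mono[of "{()}" "c ` \<Union>F"] by simp
    have "\<exists>E' F'. F' \<subseteq> F \<and> card F \<le> card F' + 2 * card (c ` \<Union>F) \<and> loc_equiv (\<Union>F) E E' \<and>
      (\<forall>S\<in>F'. \<forall>T\<in>F'. \<forall>x\<in>S. \<forall>y\<in>T. x \<noteq> y \<longrightarrow> E' x y = (S = T \<and> False))"
      by (rule remove_perturbation[where P = "\<lambda>_ _. b"])
        (use E wE in \<open>auto simp: F_def disjoint_def\<close>)
    then obtain E' F' where F': "F' \<subseteq> F" "card F \<le> card F' + 2 * card (c ` \<Union>F)" "loc_equiv (\<Union>F) E E'"
      and E': "\<forall>S\<in>F'. \<forall>T\<in>F'. \<forall>x\<in>S. \<forall>y\<in>T. x \<noteq> y \<longrightarrow> E' x y = (S = T \<and> False)"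
      by (elim exE conjE) (rule that)
    have "pieces E' 1 F'"
      unfolding pieces_def
    proof (intro conjI ballI impI)
      have single: "\<exists>x. S = {x}" if "S \<in> F'" for S using F'(1) that by (auto simp: F_def)
      show "disjoint F'"
      proof (rule disjointI)
        fix S T assume "S \<in> F'" "T \<in> F'" "S \<noteq> T"
        then show "S \<inter> T = {}" using single[of S] single[of T] by auto
      qed
      show "card S = 1" "conn E' S" if "S \<in> F'" for S
        using single[OF that] by (auto simp: conn_def)
      show "\<not> E' x y" if "S \<in> F'" "T \<in> F'" "S \<noteq> T" "x \<in> S" "y \<in> T" for S T x y
        using E' single[OF that(1)] single[OF that(2)] that by auto
    qed
    moreover have "m \<le> card F'" using F'(2) cF cc by linarith
    moreover have "loc_equiv V E E'" using loc_equiv_mono[OF F'(3) FV] .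
    ultimately show "has_pieces V E 1 m"
      unfolding has_pieces_def using F'(1) FV by blast
  qed
qed

theorem wide_has_pieces:
  fixes k m :: nat
  assumes "k \<ge> 1"
  shows "\<exists>N. \<forall>(E :: 'a \<Rightarrow> 'a \<Rightarrow> bool) V. finite V \<and> sgraph E \<and> \<not> narrow E V k N \<longrightarrow>
    has_pieces V E (k + 1) m"
  using assms
proof (induction k arbitrary: m rule: nat_induct_at_least)
  case base
  show ?case using enlarge_pieces[OF order_refl independent_set] by simp
next
  case (Suc k)
  have mono: "narrow E V (Suc k) N" if "narrow E V k N" for E V N
    using that unfolding narrow_def by (meson le_SucI)
  show ?case
  proof (rule enlarge_pieces)
    fix m
    obtain N where N: "\<forall>(E :: 'a \<Rightarrow> 'a \<Rightarrow> bool) V. finite V \<and> sgraph E \<and> \<not> narrow E V k N \<longrightarrow>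
      has_pieces V E (k + 1) m"
      using Suc.IH[of m] by (elim exE) (rule that)
    show "\<exists>N. \<forall>(E :: 'a \<Rightarrow> 'a \<Rightarrow> bool) V. finite V \<and> sgraph E \<and> \<not> narrow E V (Suc k) N \<longrightarrow>
      has_pieces V E (Suc k) m"
    proof (intro exI[of _ N] allI impI)
      fix E :: "'a \<Rightarrow> 'a \<Rightarrow> bool" and V
      assume "finite V \<and> sgraph E \<and> \<not> narrow E V (Suc k) N"
      then show "has_pieces V E (Suc k) m" using N[rule_format, of V E] mono by auto
    qed
  qed simp
qed

section \<open>Many pieces force large brittleness\<close>

text \<open>Every multigraph has a cut that contains at least half of its edges: vertices are placed
  one after another, each on the side that cuts more of the edges to the vertices placed
  before.\<close>

lemma half_cut:
  assumes "finite P" "finite J" "\<And>i. i \<in> J \<Longrightarrow> a i \<in> P \<and> b i \<in> P \<and> a i \<noteq> b i"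
  shows "\<exists>I\<subseteq>P. card J \<le> 2 * card {i \<in> J. (a i \<in> I) \<noteq> (b i \<in> I)}"
  using assms
proof (induction P arbitrary: J rule: finite_induct)
  case empty
  then have "J = {}" by blast
  then show ?case by simp
next
  case (insert p P)
  define J0 where "J0 = {i \<in> J. a i \<noteq> p \<and> b i \<noteq> p}"
  have fin: "finite J" by (fact insert)
  have ends: "\<And>i. i \<in> J \<Longrightarrow> a i \<in> insert p P \<and> b i \<in> insert p P \<and> a i \<noteq> b i" by (fact insert)
  have "\<exists>I\<subseteq>P. card J0 \<le> 2 * card {i \<in> J0. (a i \<in> I) \<noteq> (b i \<in> I)}"
    by (rule insert.IH) (use ends fin in \<open>auto simp: J0_def\<close>)
  then obtain I where I: "I \<subseteq> P" "card J0 \<le> 2 * card {i \<in> J0. (a i \<in> I) \<noteq> (b i \<in> I)}" by blast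
  define C where "C = {i \<in> J0. (a i \<in> I) \<noteq> (b i \<in> I)}"
  define X where "X = {i \<in> J - J0. a i \<in> I \<or> b i \<in> I}"
  define Y where "Y = {i \<in> J - J0. a i \<notin> I \<and> b i \<notin> I}"
  have pI: "p \<notin> I" using I(1) insert.hyps by blast
  have J: "J = J0 \<union> (X \<union> Y)" by (auto simp: J0_def X_def Y_def)
  have finC: "finite C" "finite X" "finite Y" using fin by (auto simp: C_def J0_def X_def Y_def)
  have "card J \<le> card J0 + (card X + card Y)"
    unfolding J using card_Un_le[of J0 "X \<union> Y"] card_Un_le[of X Y] by linarith
  then have cJ: "card J \<le> 2 * card C + (card X + card Y)" using I(2) by (simp add: C_def)
  have "C \<union> X \<subseteq> {i \<in> J. (a i \<in> I) \<noteq> (b i \<in> I)}"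
    using pI ends by (auto simp: C_def X_def J0_def)
  then have "card (C \<union> X) \<le> card {i \<in> J. (a i \<in> I) \<noteq> (b i \<in> I)}"
    using fin by (intro card_mono) auto
  moreover have "card (C \<union> X) = card C + card X"
    using finC by (intro card_Un_disjoint) (auto simp: C_def X_def)
  ultimately have cut1: "card C + card X \<le> card {i \<in> J. (a i \<in> I) \<noteq> (b i \<in> I)}" by simp
  have "C \<union> Y \<subseteq> {i \<in> J. (a i \<in> insert p I) \<noteq> (b i \<in> insert p I)}"
  proof
    fix i assume "i \<in> C \<union> Y"
    then show "i \<in> {i \<in> J. (a i \<in> insert p I) \<noteq> (b i \<in> insert p I)}"
      using ends[of i] pI unfolding C_def Y_def J0_def by (cases "a i = p"; cases "b i = p") auto
  qed
  then have "card (C \<union> Y) \<le> card {i \<in> J. (a i \<in> insert p I) \<noteq> (b i \<in> insert p I)}"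
    using fin by (intro card_mono) auto
  moreover have "card (C \<union> Y) = card C + card Y"
    using finC by (intro card_Un_disjoint) (auto simp: C_def Y_def)
  ultimately have cut2: "card C + card Y \<le> card {i \<in> J. (a i \<in> insert p I) \<noteq> (b i \<in> insert p I)}" by simp
  show ?case
  proof (cases "card X \<ge> card Y")
    case True
    then show ?thesis using cJ cut1 I(1) by (intro exI[of _ I]) auto
  next
    case False
    then show ?thesis using cJ cut2 I(1) by (intro exI[of _ "insert p I"]) auto
  qed
qed

lemma cutrank_ge:
  assumes V: "finite V" and T: "T \<subseteq> V"
    and ab: "\<And>i. i \<in> J \<Longrightarrow> a i \<in> T \<and> b i \<in> V - T"
    and E: "\<And>i j. i \<in> J \<Longrightarrow> j \<in> J \<Longrightarrow> E (a i) (b j) \<longleftrightarrow> i = j"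
  shows "card J \<le> cutrank E V T"
proof -
  define u where "u i = row E (V - T) (a i)" for i
  have u: "u i (b j) = (if i = j then 1 else 0)" if "i \<in> J" "j \<in> J" for i j
    using E[OF that] ab[OF that(2)] by (simp add: u_def row_def)
  have inj: "inj_on u J" using u by (metis inj_onI zero_neq_one)
  have ind: "fun_space.independent (u ` J)"
  proof
    assume "fun_space.dependent (u ` J)"
    then obtain i where i: "i \<in> J" "u i \<in> fun_space.span (u ` J - {u i})"
      unfolding fun_space.dependent_def by blast
    have "fun_space.span (u ` J - {u i}) \<subseteq> {w. w (b i) = 0}"
    proof (rule fun_space.span_minimal)
      show "fun_space.subspace {w. w (b i) = 0}"
        by (rule fun_space.subspaceI) simp_all
      show "u ` J - {u i} \<subseteq> {w. w (b i) = 0}" using u i(1) by auto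
    qed
    then have "u i (b i) = 0" using i(2) by blast
    then show False using u[OF i(1) i(1)] by simp
  qed
  obtain B where B: "B \<subseteq> row E (V - T) ` T" "fun_space.independent B"
    "row E (V - T) ` T \<subseteq> fun_space.span B" "card B = fun_space.dim (row E (V - T) ` T)"
    by (rule fun_space.basis_exists)
  have "finite B" by (rule finite_subset[OF B(1)]) (use V T finite_subset in auto)
  moreover have "u ` J \<subseteq> fun_space.span B" using B(3) ab by (auto simp: u_def)
  ultimately have "card (u ` J) \<le> card B" using fun_space.independent_span_bound[OF _ ind] by blast
  then show ?thesis using inj B(4) by (simp add: card_image cutrank_def)
qed

text \<open>Every piece meets two parts.  Regarding them as the ends of an edge between parts,
  \<open>half_cut\<close> yields a union of parts that splits at least half of the pieces.  Each
  split piece has an edge across.\<close>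

lemma card_pieces_le_if_narrow:
  assumes V: "finite V" and F: "pieces E (k + 1) F" "\<Union>F \<subseteq> V" and narrow: "narrow E V k N"
  shows "card F \<le> 2 * N"
proof -
  obtain P where P: "partition_on V P" "\<forall>S\<in>P. card S \<le> k" "\<forall>I\<subseteq>P. cutrank E V (\<Union>I) \<le> N"
    using narrow unfolding narrow_def by blast
  have finP: "finite P" by (rule finite_elements[OF V P(1)])
  have finF: "finite F" by (rule finite_Union_pieces[OF F(1) V F(2)])
  have "\<exists>p q. p \<in> P \<and> q \<in> P \<and> p \<noteq> q \<and> p \<inter> S \<noteq> {} \<and> q \<inter> S \<noteq> {}" if S: "S \<in> F" for S
  proof -
    have cS: "card S = k + 1" and "S \<subseteq> V" using F S by (auto simp: pieces_def)
    then obtain x where x: "x \<in> S" by fastforce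
    then obtain p where p: "p \<in> P" "x \<in> p" using P(1) \<open>S \<subseteq> V\<close> by (auto simp: partition_on_def)
    have "p \<subseteq> V" using P(1) p(1) by (auto simp: partition_on_def)
    then have "finite p" using V finite_subset by blast
    then have "\<not> S \<subseteq> p" using P(2) p(1) cS card_mono[of p S] by fastforce
    then obtain y where y: "y \<in> S" "y \<notin> p" by blast
    then obtain q where "q \<in> P" "y \<in> q" using P(1) \<open>S \<subseteq> V\<close> by (auto simp: partition_on_def)
    then show ?thesis using p x y by blast
  qed
  then obtain p q where pq: "\<And>S. S \<in> F \<Longrightarrow> p S \<in> P \<and> q S \<in> P \<and> p S \<noteq> q S"
    "\<And>S. S \<in> F \<Longrightarrow> p S \<inter> S \<noteq> {}" "\<And>S. S \<in> F \<Longrightarrow> q S \<inter> S \<noteq> {}" by metis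
  obtain I where I: "I \<subseteq> P" "card F \<le> 2 * card {S \<in> F. (p S \<in> I) \<noteq> (q S \<in> I)}"
    using half_cut[OF finP finF, of p q] pq(1) by blast
  define J where "J = {S \<in> F. (p S \<in> I) \<noteq> (q S \<in> I)}"
  have out: "r \<inter> \<Union>I = {}" if "r \<in> P" "r \<notin> I" for r
  proof -
    have "disjoint P" using P(1) by (simp add: partition_on_def)
    then have "r \<inter> s = {}" if "s \<in> I" for s using \<open>r \<in> P\<close> \<open>r \<notin> I\<close> that I(1) by (metis disjointD subsetD)
    then show ?thesis by blast
  qed
  have "\<exists>a b. a \<in> S \<inter> \<Union>I \<and> b \<in> S - \<Union>I \<and> E a b" if "S \<in> J" for S
  proof -
    have S: "S \<in> F" and cut: "(p S \<in> I) \<noteq> (q S \<in> I)" using that by (auto simp: J_def)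
    obtain x y where xy: "x \<in> p S" "x \<in> S" "y \<in> q S" "y \<in> S" using pq(2,3)[OF S] by blast
    have "S \<inter> \<Union>I \<noteq> {} \<and> S \<inter> \<Union>I \<noteq> S"
    proof (cases "p S \<in> I")
      case True
      then have "y \<notin> \<Union>I" using out[of "q S"] pq(1)[OF S] cut xy by blast
      then show ?thesis using True xy by blast
    next
      case False
      then have "x \<notin> \<Union>I" using out[of "p S"] pq(1)[OF S] xy by blast
      then show ?thesis using False cut xy by blast
    qed
    moreover have "conn E S" using F(1) S by (simp add: pieces_def)
    ultimately have "\<exists>a\<in>S \<inter> \<Union>I. \<exists>b\<in>S - S \<inter> \<Union>I. E a b" unfolding conn_def by blast
    then show ?thesis by blast
  qed
  then obtain a b where ab: "\<And>S. S \<in> J \<Longrightarrow> a S \<in> S \<inter> \<Union>I" "\<And>S. S \<in> J \<Longrightarrow> b S \<in> S - \<Union>I"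
    "\<And>S. S \<in> J \<Longrightarrow> E (a S) (b S)" by metis
  have JF: "S \<in> F" if "S \<in> J" for S using that by (simp add: J_def)
  have "card J \<le> cutrank E V (\<Union>I)"
  proof (rule cutrank_ge[OF V, where a = a and b = b])
    show "\<Union>I \<subseteq> V" using I(1) P(1) by (auto simp: partition_on_def)
    show "a S \<in> \<Union>I \<and> b S \<in> V - \<Union>I" if "S \<in> J" for S
      using ab(1,2)[OF that] JF[OF that] F(2) by blast
    show "E (a S) (b T) = (S = T)" if "S \<in> J" "T \<in> J" for S T
    proof (cases "S = T")
      case False
      then show ?thesis
        using F(1) JF[OF that(1)] JF[OF that(2)] ab(1)[OF that(1)] ab(2)[OF that(2)]
        unfolding pieces_def by blast
    qed (use ab(3) that in simp)
  qed
  also have "\<dots> \<le> N" using P(3) I(1) by blast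
  finally show ?thesis using I(2) by (simp add: J_def)
qed

section \<open>Translation to pair graphs\<close>

abbreviation adj :: "'a pair_pre_digraph \<Rightarrow> 'a \<Rightarrow> 'a \<Rightarrow> bool" where
  "adj G \<equiv> \<lambda>a b. (a, b) \<in> parcs G"

definition graph_of :: "'a set \<Rightarrow> ('a \<Rightarrow> 'a \<Rightarrow> bool) \<Rightarrow> 'a pair_pre_digraph" where
  "graph_of V E = \<lparr>pverts = V, parcs = {(x, y). x \<in> V \<and> y \<in> V \<and> E x y}\<rparr>"

lemma graph_of_simps [simp]:
  "pverts (graph_of V E) = V" "(x, y) \<in> parcs (graph_of V E) \<longleftrightarrow> x \<in> V \<and> y \<in> V \<and> E x y"
  by (simp_all add: graph_of_def)

lemma pair_graph_graph_of: "finite V \<Longrightarrow> sgraph E \<Longrightarrow> pair_graph (graph_of V E)"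
  by (auto simp: pair_graph_iff sgraph_def sym_def irrefl_def)

lemma sgraph_adj: "pair_graph G \<Longrightarrow> sgraph (adj G)"
  by (auto simp: pair_graph_iff sgraph_def sym_def irrefl_def)

lemma graph_of_adj: "pair_graph G \<Longrightarrow> graph_of (pverts G) (adj G) = G"
  by (auto simp: pair_graph_iff intro!: pair_pre_digraph.equality)

lemma wf_with_proj: "pair_graph G \<Longrightarrow> wf_digraph (with_proj G)"
  by unfold_locales (auto simp: pair_graph_iff)

lemma cut_rank_eq_cutrank: "cut_rank G S = int (cutrank (adj G) (pverts G) S)"
proof -
  have "(\<lambda>a b. if b \<in> T then if adj G a b then 1 else 0 else 0 :: bit) = row (adj G) T" for T
    by (auto simp: row_def fun_eq_iff)
  then show ?thesis by (simp only: cut_rank_def matrix_rank_on_def cutrank_def)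
qed

lemma rank_brittleness_le_iff:
  assumes "finite (pverts G)" "k \<ge> 1"
  shows "rank_brittleness k G \<le> int N \<longleftrightarrow> narrow (adj G) (pverts G) k N"
proof -
  have "f_width (cut_rank G) P \<le> int N \<longleftrightarrow> (\<forall>I\<subseteq>P. cutrank (adj G) (pverts G) (\<Union>I) \<le> N)"
    if "partition_on (pverts G) P" for P
  proof -
    have "f_width (cut_rank G) P \<le> int N \<longleftrightarrow> (\<forall>a\<in>{cut_rank G (\<Union>I) | I. I \<subseteq> P}. a \<le> int N)"
      unfolding f_width_def by (rule Max_le_iff[OF finite_f_width_values[OF assms(1) that]])
    also have "\<dots> \<longleftrightarrow> (\<forall>I\<subseteq>P. cut_rank G (\<Union>I) \<le> int N)" by blast
    finally show ?thesis by (simp add: cut_rank_eq_cutrank)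
  qed
  then show ?thesis
    unfolding rank_brittleness_def brittleness_def narrow_def
    using finite_brittleness_values[OF assms, of "cut_rank G"]
    by (subst Min_le_iff) auto
qed

lemma rank_scattered_iff:
  assumes "k \<ge> 1" "\<And>G. G \<in> \<C> \<Longrightarrow> finite (pverts G)"
  shows "rank_scattered k \<C> \<longleftrightarrow> (\<exists>N. \<forall>G\<in>\<C>. narrow (adj G) (pverts G) k N)"
proof
  assume "rank_scattered k \<C>"
  then obtain c where "\<forall>G\<in>\<C>. rank_brittleness k G \<le> c" unfolding rank_scattered_def by blast
  then have "\<forall>G\<in>\<C>. rank_brittleness k G \<le> int (nat c)" by fastforce
  then show "\<exists>N. \<forall>G\<in>\<C>. narrow (adj G) (pverts G) k N"
    using rank_brittleness_le_iff[OF assms(2,1)] by blast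
next
  assume "\<exists>N. \<forall>G\<in>\<C>. narrow (adj G) (pverts G) k N"
  then show "rank_scattered k \<C>"
    unfolding rank_scattered_def using rank_brittleness_le_iff[OF assms(2,1)] by blast
qed

lemma locally_equivalent_graph_of:
  assumes "pair_graph G" "loc_equiv (pverts G) (adj G) E"
  shows "locally_equivalent G (graph_of (pverts G) E)"
  using assms(2)
proof (induction rule: loc_equiv_induct)
  case refl
  then show ?case using graph_of_adj[OF assms(1)] by (simp add: locally_equivalent_def)
next
  case (step E v)
  let ?G = "graph_of (pverts G) E"
  have "sgraph E" by (rule sgraph_loc_equiv[OF _ sgraph_adj[OF assms(1)]]) (fact step)
  then have "graph_of (pverts G) (lc E v) = local_complement ?G v"
    using \<open>v \<in> pverts G\<close>
    by (intro pair_pre_digraph.equality) (auto simp: graph_of_def local_complement_def lc_def sgraph_def Let_def)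
  moreover have "locally_equivalent G ?G" by (fact step)
  ultimately show ?case
    using \<open>v \<in> pverts G\<close> unfolding locally_equivalent_def
    by (metis (mono_tags, lifting) graph_of_simps(1) rtranclp.rtrancl_into_rtrancl)
qed

lemma induced_graph_of:
  assumes "U \<subseteq> V" "finite V" "sgraph E"
  shows "induced_subgraph (with_proj (graph_of U E)) (with_proj (graph_of V E))"
proof -
  have "wf_digraph (with_proj (graph_of U E))" "wf_digraph (with_proj (graph_of V E))"
    using assms finite_subset by (auto intro!: wf_with_proj pair_graph_graph_of)
  then show ?thesis
    using assms(1) by (auto simp: induced_subgraph_def subgraph_def graph_of_def)
qed

lemma graph_isoI:
  assumes "pair_graph G" "bij_betw f (pverts G) (pverts H)" "parcs H \<subseteq> pverts H \<times> pverts H"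
    and adj: "\<And>x y. x \<in> pverts G \<Longrightarrow> y \<in> pverts G \<Longrightarrow> (x, y) \<in> parcs G \<longleftrightarrow> (f x, f y) \<in> parcs H"
  shows "graph_iso G H"
proof -
  define hom where "hom = \<lparr>iso_verts = f, iso_arcs = map_prod f f, iso_head = snd, iso_tail = fst\<rparr>"
  have sub: "parcs G \<subseteq> pverts G \<times> pverts G" using assms(1) by (simp add: pair_graph_iff)
  have inj: "inj_on f (pverts G)" and img: "f ` pverts G = pverts H"
    using assms(2) by (auto simp: bij_betw_def)
  have "inj_on (map_prod f f) (parcs G)"
    by (rule inj_on_subset[OF map_prod_inj_on[OF inj inj] sub])
  then have "pre_digraph.digraph_isomorphism (with_proj G) hom"
    using wf_with_proj[OF assms(1)] inj by (auto simp: pre_digraph.digraph_isomorphism_def hom_def)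
  moreover have "parcs H = map_prod f f ` parcs G"
  proof (intro set_eqI iffI)
    fix e assume e: "e \<in> parcs H"
    then obtain x y where "x \<in> pverts G" "y \<in> pverts G" "e = (f x, f y)"
      using assms(3) img by blast
    then show "e \<in> map_prod f f ` parcs G" using e adj by (auto intro!: rev_image_eqI)
  next
    fix e assume "e \<in> map_prod f f ` parcs G"
    then show "e \<in> parcs H" using sub adj by auto
  qed
  then have "with_proj H = app_iso hom (with_proj G)"
    using img by (simp add: app_iso_def hom_def with_proj_def)
  ultimately show ?thesis unfolding digraph_iso_def by blast
qed

lemma graph_isoE:
  assumes "graph_iso G H" "parcs G \<subseteq> pverts G \<times> pverts G"
  obtains f where "bij_betw f (pverts G) (pverts H)"
    "\<And>x y. x \<in> pverts G \<Longrightarrow> y \<in> pverts G \<Longrightarrow> (x, y) \<in> parcs G \<longleftrightarrow> (f x, f y) \<in> parcs H"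
proof -
  obtain hom where hom: "pre_digraph.digraph_isomorphism (with_proj G) hom"
    and H: "with_proj H = app_iso hom (with_proj G)"
    using assms(1) unfolding digraph_iso_def by (elim exE conjE) (rule that)
  define f where "f = iso_verts hom"
  have verts: "pverts H = f ` pverts G" and arcs: "parcs H = iso_arcs hom ` parcs G"
    and ht: "iso_tail hom = fst" "iso_head hom = snd"
    using H by (auto simp: app_iso_def with_proj_def f_def)
  have inj: "inj_on f (pverts G)"
    using hom by (simp add: pre_digraph.digraph_isomorphism_def f_def)
  have "\<forall>e\<in>parcs G. f (fst e) = fst (iso_arcs hom e) \<and> f (snd e) = snd (iso_arcs hom e)"
    using hom by (simp add: pre_digraph.digraph_isomorphism_def ht f_def)
  then have "iso_arcs hom (x, y) = (f x, f y)" if "(x, y) \<in> parcs G" for x y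
    using that by (fastforce simp: prod_eq_iff)
  then have arcs': "parcs H = (\<lambda>e. (f (fst e), f (snd e))) ` parcs G"
    unfolding arcs by (intro image_cong refl) (metis prod.collapse)
  show ?thesis
  proof (rule that[of f])
    show "bij_betw f (pverts G) (pverts H)" using inj verts by (simp add: bij_betw_def)
    fix x y assume xy: "x \<in> pverts G" "y \<in> pverts G"
    show "(x, y) \<in> parcs G \<longleftrightarrow> (f x, f y) \<in> parcs H"
    proof
      assume "(f x, f y) \<in> parcs H"
      then obtain x' y' where "(x', y') \<in> parcs G" "f x = f x'" "f y = f y'" 
        unfolding arcs' by auto
      moreover from this have "x' \<in> pverts G" "y' \<in> pverts G" using assms(2) by auto
      ultimately show "(x, y) \<in> parcs G" using inj xy by (auto dest: inj_onD)
    next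
      assume "(x, y) \<in> parcs G"
      then show "(f x, f y) \<in> parcs H" unfolding arcs' by (rule rev_image_eqI) simp
    qed
  qed
qed

lemma connected_iff_conn:
  assumes "pair_graph H"
  shows "Digraph_Component.connected (with_proj H) \<longleftrightarrow> conn (adj H) (pverts H)"
proof -
  have sub: "parcs H \<subseteq> pverts H \<times> pverts H" and sym: "sym (parcs H)"
    using assms by (auto simp: pair_graph_iff)
  have "parcs (mk_symmetric (with_proj H)) = parcs H"
    using sym by (auto simp: parcs_mk_symmetric sym_def)
  then have reach: "Digraph_Component.connected (with_proj H) \<longleftrightarrow>
    pverts H \<noteq> {} \<and> (\<forall>u\<in>pverts H. \<forall>v\<in>pverts H. (u, v) \<in> rtrancl_on (pverts H) (parcs H))"
    by (simp add: Digraph_Component.connected_def strongly_connected_def reachable_def)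
  show ?thesis
  proof
    assume "Digraph_Component.connected (with_proj H)"
    then have ne: "pverts H \<noteq> {}"
      and r: "\<And>u v. u \<in> pverts H \<Longrightarrow> v \<in> pverts H \<Longrightarrow> (u, v) \<in> rtrancl_on (pverts H) (parcs H)"
      using reach by auto
    show "conn (adj H) (pverts H)"
      unfolding conn_def
    proof (intro conjI ne allI impI, rule ccontr)
      fix A assume A: "A \<subseteq> pverts H \<and> A \<noteq> {} \<and> A \<noteq> pverts H"
        and none: "\<not> (\<exists>x\<in>A. \<exists>y\<in>pverts H - A. (x, y) \<in> parcs H)"
      then obtain u v where u: "u \<in> A" "u \<in> pverts H" and v: "v \<in> pverts H" "v \<notin> A" by blast
      from r[OF u(2) v(1)] have "v \<in> A"
        by (induction rule: rtrancl_on_induct) (use u none in auto)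
      then show False using v(2) by simp
    qed
  next
    assume c: "conn (adj H) (pverts H)"
    have "(u, v) \<in> rtrancl_on (pverts H) (parcs H)" if uv: "u \<in> pverts H" "v \<in> pverts H" for u v
    proof -
      define A where "A = {v. (u, v) \<in> rtrancl_on (pverts H) (parcs H)}"
      have "A \<subseteq> pverts H" by (auto simp: A_def dest: in_rtrancl_on_in_F)
      moreover have "u \<in> A" using uv by (simp add: A_def)
      moreover have "y \<in> A" if "x \<in> A" "y \<in> pverts H" "(x, y) \<in> parcs H" for x y
        using that by (auto simp: A_def intro: rtrancl_on_into_rtrancl_on)
      ultimately have "A = pverts H" using c unfolding conn_def by blast
      then show ?thesis using uv by (auto simp: A_def)
    qed
    then show "Digraph_Component.connected (with_proj H)"
      using reach c by (auto simp: conn_def)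
  qed
qed

lemma conn_image:
  assumes "conn E S" "\<And>x y. x \<in> S \<Longrightarrow> y \<in> S \<Longrightarrow> E x y \<Longrightarrow> E' (h x) (h y)"
  shows "conn E' (h ` S)"
  unfolding conn_def
proof (intro conjI allI impI)
  show "h ` S \<noteq> {}" using assms(1) by (simp add: conn_def)
  fix A assume A: "A \<subseteq> h ` S \<and> A \<noteq> {} \<and> A \<noteq> h ` S"
  define A' where "A' = {x \<in> S. h x \<in> A}"
  have "A' \<subseteq> S \<and> A' \<noteq> {} \<and> A' \<noteq> S" using A by (auto simp: A'_def)
  then obtain x y where "x \<in> A'" "y \<in> S - A'" "E x y"
    using assms(1) unfolding conn_def by metis
  then show "\<exists>x\<in>A. \<exists>y\<in>h ` S - A. E' x y"
    using assms(2)[of x y] by (auto simp: A'_def)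
qed

section \<open>Copies of one graph\<close>

lemma copies_simps [simp]:
  "pverts (copies m H) = {..<m} \<times> pverts H"
  "((i, u), (j, v)) \<in> parcs (copies m H) \<longleftrightarrow> i = j \<and> i < m \<and> (u, v) \<in> parcs H"
  by (auto simp: copies_def)

lemma le_if_narrow_copies:
  assumes G: "pair_graph G" and H: "pair_graph H" "conn (adj H) (pverts H)" "card (pverts H) = k + 1"
    and iso: "graph_iso G (copies m H)" and narrow: "narrow (adj G) (pverts G) k N"
  shows "m \<le> 2 * N"
proof -
  obtain f where f: "bij_betw f (pverts G) (pverts (copies m H))"
    and fE: "\<And>x y. x \<in> pverts G \<Longrightarrow> y \<in> pverts G \<Longrightarrow> (x, y) \<in> parcs G \<longleftrightarrow> (f x, f y) \<in> parcs (copies m H)"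
    using graph_isoE[OF iso] G unfolding pair_graph_iff by metis
  define g where "g = inv_into (pverts G) f"
  have g: "bij_betw g ({..<m} \<times> pverts H) (pverts G)"
    using bij_betw_inv_into[OF f] by (simp add: g_def)
  have gV: "g (i, u) \<in> pverts G" if "i < m" "u \<in> pverts H" for i u
    using g that by (auto simp: bij_betw_def)
  have "f (g x) = x" if "x \<in> {..<m} \<times> pverts H" for x
    using f that by (auto simp: g_def bij_betw_def f_inv_into_f)
  then have gE: "adj G (g (i, u)) (g (j, v)) \<longleftrightarrow> i = j \<and> adj H u v"
    if "i < m" "j < m" "u \<in> pverts H" "v \<in> pverts H" for i j u v
    using fE[OF gV gV, of i u j v] that by simp
  define S where "S i = (\<lambda>u. g (i, u)) ` pverts H" for i
  have inj: "g (i, u) = g (j, v) \<longleftrightarrow> i = j \<and> u = v"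
    if "i < m" "j < m" "u \<in> pverts H" "v \<in> pverts H" for i j u v
    using g that by (auto simp: bij_betw_def inj_on_def)
  have ne: "pverts H \<noteq> {}" using H(3) by fastforce
  have Sdis: "S i \<inter> S j = {}" if "i < m" "j < m" "i \<noteq> j" for i j
    using inj that by (fastforce simp: S_def)
  have "S i \<noteq> {}" for i using ne by (simp add: S_def)
  then have "inj_on S {..<m}" using Sdis by (metis inf.idem inj_onI lessThan_iff)
  then have "card (S ` {..<m}) = m" by (simp add: card_image)
  moreover have "pieces (adj G) (k + 1) (S ` {..<m})"
    unfolding pieces_def
  proof (intro conjI ballI impI)
    show "disjoint (S ` {..<m})" using Sdis by (auto simp: disjoint_def)
    fix A assume "A \<in> S ` {..<m}"
    then obtain i where i: "i < m" "A = S i" by blast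
    have "inj_on (\<lambda>u. g (i, u)) (pverts H)" using inj[OF i(1) i(1)] by (auto simp: inj_on_def)
    then show "card A = k + 1" using H(3) i(2) by (simp add: S_def card_image)
    show "conn (adj G) A"
      unfolding i(2) S_def by (rule conn_image[OF H(2)]) (use gE i(1) in auto)
  next
    fix A B x y assume "A \<in> S ` {..<m}" "B \<in> S ` {..<m}" "A \<noteq> B" "x \<in> A" "y \<in> B"
    then obtain i j where "i < m" "j < m" "i \<noteq> j" "x \<in> S i" "y \<in> S j" by blast
    moreover from this obtain u v where "u \<in> pverts H" "v \<in> pverts H" "x = g (i, u)" "y = g (j, v)"
      unfolding S_def by blast
    ultimately show "\<not> adj G x y" using gE[of i j u v] by blast
  qed
  moreover have "\<Union>(S ` {..<m}) \<subseteq> pverts G" using gV by (auto simp: S_def)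
  moreover have "finite (pverts G)" using G by (simp add: pair_graph_iff)
  ultimately show ?thesis using card_pieces_le_if_narrow[OF _ _ _ narrow] by metis
qed

text \<open>All pieces are compared with graphs on one fixed vertex set \<open>W\<close>, which
  leaves finitely many edge sets \<open>T\<close>.\<close>

definition has_copies :: "'a set \<Rightarrow> ('a \<Rightarrow> 'a \<Rightarrow> bool) \<Rightarrow> nat \<Rightarrow> 'b set \<Rightarrow> ('b \<times> 'b) set \<Rightarrow> bool" where
  "has_copies V E m W T \<longleftrightarrow> (\<exists>E' F h. loc_equiv V E E' \<and> pieces E' (card W) F \<and> \<Union>F \<subseteq> V \<and> card F = m \<and>
    (\<forall>S\<in>F. bij_betw (h S) W S \<and> (\<forall>a\<in>W. \<forall>b\<in>W. E' (h S a) (h S b) \<longleftrightarrow> (a, b) \<in> T)))"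

lemma pieces_subset:
  assumes F: "pieces E k F" and sub: "F' \<subseteq> F"
  shows "pieces E k F'"
  unfolding pieces_def
proof (intro conjI ballI impI)
  show "disjoint F'" using F sub by (auto simp: pieces_def intro: pairwise_subset)
  show "card S = k" "conn E S" if "S \<in> F'" for S
    using F subsetD[OF sub that] by (simp_all add: pieces_def)
  show "\<not> E x y" if "S \<in> F'" "T \<in> F'" "S \<noteq> T" "x \<in> S" "y \<in> T" for S T x y
    using F subsetD[OF sub that(1)] subsetD[OF sub that(2)] that(3-5) by (simp add: pieces_def)
qed

lemma has_copies_mono:
  assumes "has_copies V E m W T" "m' \<le> m"
  shows "has_copies V E m' W T"
proof -
  obtain E' F h where *: "loc_equiv V E E'" "pieces E' (card W) F" "\<Union>F \<subseteq> V" "card F = m"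
    "\<forall>S\<in>F. bij_betw (h S) W S \<and> (\<forall>a\<in>W. \<forall>b\<in>W. E' (h S a) (h S b) \<longleftrightarrow> (a, b) \<in> T)"
    using assms(1) unfolding has_copies_def by (elim exE conjE) (rule that)
  obtain F' where F': "F' \<subseteq> F" "card F' = m'"
    using obtain_subset_with_card_n[of m' F] assms(2) *(4) by blast
  show ?thesis
    unfolding has_copies_def
  proof (intro exI conjI)
    show "pieces E' (card W) F'" by (rule pieces_subset[OF *(2) F'(1)])
    show "\<Union>F' \<subseteq> V" using *(3) F'(1) by blast
    show "\<forall>S\<in>F'. bij_betw (h S) W S \<and> (\<forall>a\<in>W. \<forall>b\<in>W. E' (h S a) (h S b) \<longleftrightarrow> (a, b) \<in> T)"
      using *(5) F'(1) by blast
  qed (use * F' in auto)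
qed

lemma has_copies_pigeonhole:
  assumes V: "finite V" and W: "finite W" and "m \<ge> 1"
    and pieces: "has_pieces V E (card W) (m * card (Pow (W \<times> W)))"
  shows "\<exists>T\<subseteq>W \<times> W. has_copies V E m W T"
proof -
  obtain E' F where E': "loc_equiv V E E'" and F: "pieces E' (card W) F" "\<Union>F \<subseteq> V"
    and cF: "m * card (Pow (W \<times> W)) \<le> card F"
    using pieces unfolding has_pieces_def by blast
  have finF: "finite F" by (rule finite_Union_pieces[OF F(1) V F(2)])
  have "\<exists>h. bij_betw h W S" if "S \<in> F" for S
  proof -
    have "finite S" by (rule finite_subset[OF _ V]) (use F(2) that in blast)
    moreover have "card S = card W" using F(1) that by (simp add: pieces_def)
    ultimately show ?thesis using W finite_same_card_bij by metis
  qed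
  then obtain h where h: "\<And>S. S \<in> F \<Longrightarrow> bij_betw (h S) W S" by metis
  define t where "t S = {(a, b). a \<in> W \<and> b \<in> W \<and> E' (h S a) (h S b)}" for S
  have "\<exists>T\<in>Pow (W \<times> W). m \<le> card {S \<in> F. t S = T}"
  proof (rule ccontr)
    assume "\<not> ?thesis"
    then have big: "\<not> m \<le> card {S \<in> F. t S = T}" if "T \<in> Pow (W \<times> W)" for T using that by blast
    have small: "card {S \<in> F. t S = T} \<le> m - 1" if "T \<in> Pow (W \<times> W)" for T
      using big[OF that] by simp
    have "t S \<in> Pow (W \<times> W)" for S by (auto simp: t_def)
    then have "F = (\<Union>T\<in>Pow (W \<times> W). {S \<in> F. t S = T})" by blast
    then have "card F = card (\<Union>T\<in>Pow (W \<times> W). {S \<in> F. t S = T})" by (rule arg_cong)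
    also have "\<dots> \<le> (\<Sum>T\<in>Pow (W \<times> W). card {S \<in> F. t S = T})"
      by (rule card_UN_le) (simp add: W)
    also have "\<dots> \<le> (m - 1) * card (Pow (W \<times> W))"
      using sum_bounded_above[of "Pow (W \<times> W)" _ "m - 1"] small by (simp add: mult.commute)
    also have "\<dots> < m * card (Pow (W \<times> W))"
      using \<open>m \<ge> 1\<close> W by (simp add: card_Pow)
    finally show False using cF by simp
  qed
  then obtain T where T: "T \<subseteq> W \<times> W" "m \<le> card {S \<in> F. t S = T}" by blast
  obtain F' where F': "F' \<subseteq> {S \<in> F. t S = T}" "card F' = m"
    by (rule obtain_subset_with_card_n[OF T(2)])
  have "has_copies V E m W T"
    unfolding has_copies_def
  proof (intro exI conjI)
    show "loc_equiv V E E'" by fact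
    show "pieces E' (card W) F'" by (rule pieces_subset[OF F(1)]) (use F'(1) in blast)
    show "\<Union>F' \<subseteq> V" using F'(1) F(2) by blast
    show "\<forall>S\<in>F'. bij_betw (h S) W S \<and> (\<forall>a\<in>W. \<forall>b\<in>W. E' (h S a) (h S b) \<longleftrightarrow> (a, b) \<in> T)"
      using F'(1) h by (auto simp: t_def)
  qed fact
  then show ?thesis using T(1) by blast
qed

lemma has_copies_graph:
  assumes E: "sgraph E" and W: "finite W" and T: "T \<subseteq> W \<times> W" and copies: "has_copies V E 1 W T"
  defines "H \<equiv> \<lparr>pverts = W, parcs = T\<rparr>"
  shows "pair_graph H" "conn (adj H) (pverts H)"
proof -
  obtain E' F h where *: "loc_equiv V E E'" "pieces E' (card W) F" "\<Union>F \<subseteq> V" "card F = 1"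
    "\<forall>S\<in>F. bij_betw (h S) W S \<and> (\<forall>a\<in>W. \<forall>b\<in>W. E' (h S a) (h S b) \<longleftrightarrow> (a, b) \<in> T)"
    using copies unfolding has_copies_def by (elim exE conjE) (rule that)
  obtain S where S: "S \<in> F" using *(4) by fastforce
  define g where "g = inv_into W (h S)"
  have hS: "bij_betw (h S) W S" and hE: "\<And>a b. a \<in> W \<Longrightarrow> b \<in> W \<Longrightarrow> E' (h S a) (h S b) \<longleftrightarrow> (a, b) \<in> T"
    using *(5) S by blast+
  have E': "sgraph E'" by (rule sgraph_loc_equiv[OF *(1) E])
  have "(b, a) \<in> T" if "(a, b) \<in> T" for a b
    using that T hE E' unfolding sgraph_def by blast
  moreover have "(a, a) \<notin> T" for a
    using T hE E' unfolding sgraph_def by blast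
  ultimately show "pair_graph H"
    using W T by (auto simp: H_def pair_graph_iff sym_def irrefl_def)
  have gW: "g x \<in> W" "h S (g x) = x" if "x \<in> S" for x
    using hS that by (auto simp: g_def bij_betw_def inv_into_into f_inv_into_f)
  have "conn E' S" using *(2) S by (simp add: pieces_def)
  then have "conn (adj H) (g ` S)"
    by (rule conn_image) (use hE[OF gW(1) gW(1)] gW(2) in \<open>auto simp: H_def\<close>)
  moreover have "g ` S = W" using bij_betw_inv_into[OF hS] by (simp add: g_def bij_betw_def)
  ultimately show "conn (adj H) (pverts H)" by (simp add: H_def)
qed

lemma contains_copies:
  assumes \<C>: "vertex_minor_ideal \<C>" and G: "G \<in> \<C>" and W: "finite W" and T: "T \<subseteq> W \<times> W"
    and copies: "has_copies (pverts G) (adj G) m W T"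
    and H: "pair_graph \<lparr>pverts = W, parcs = T\<rparr>"
  shows "contains_graph \<C> (copies m \<lparr>pverts = W, parcs = T\<rparr>)"
proof -
  let ?V = "pverts G" and ?H = "\<lparr>pverts = W, parcs = T\<rparr>"
  have pG: "pair_graph G" using \<C> G by (simp add: vertex_minor_ideal_def)
  then have V: "finite ?V" and sG: "sgraph (adj G)" by (simp_all add: pair_graph_iff sgraph_adj)
  obtain E' F h where E': "loc_equiv ?V (adj G) E'" and F: "pieces E' (card W) F" "\<Union>F \<subseteq> ?V" "card F = m"
    and h: "\<forall>S\<in>F. bij_betw (h S) W S \<and> (\<forall>a\<in>W. \<forall>b\<in>W. E' (h S a) (h S b) \<longleftrightarrow> (a, b) \<in> T)"
    using copies unfolding has_copies_def by (elim exE conjE) (rule that)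
  have sE': "sgraph E'" by (rule sgraph_loc_equiv[OF E' sG])
  define K where "K = graph_of (\<Union>F) E'"
  have pK: "pair_graph K"
    unfolding K_def using V F(2) finite_subset sE' by (intro pair_graph_graph_of) auto
  have "vertex_minor K G"
    unfolding vertex_minor_def K_def
    using locally_equivalent_graph_of[OF pG E'] induced_graph_of[OF F(2) V sE'] by blast
  moreover have "graph_iso K K"
    by (rule graph_isoI[OF pK, of id]) (use pK in \<open>auto simp: pair_graph_iff\<close>)
  ultimately have "K \<in> \<C>" using \<C> G unfolding vertex_minor_ideal_def by blast
  have finF: "finite F" by (rule finite_Union_pieces[OF F(1) V F(2)])
  obtain e where e: "bij_betw e {..<m} F"
    using finF F(3) by (metis ex_bij_betw_nat_finite atLeast0LessThan)
  have eF: "e i \<in> F" if "i < m" for i using e that by (auto simp: bij_betw_def)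
  have einj: "e i = e j \<longleftrightarrow> i = j" if "i < m" "j < m" for i j
    using e that by (auto simp: bij_betw_def inj_on_def)
  have hS: "h (e i) u \<in> e i" if "i < m" "u \<in> W" for i u
    using h eF[OF that(1)] that(2) by (auto simp: bij_betw_def)
  have apart: "e i \<inter> e j = {} \<and> (\<forall>x\<in>e i. \<forall>y\<in>e j. \<not> E' x y)" if "i < m" "j < m" "i \<noteq> j" for i j
    using F(1) eF[OF that(1)] eF[OF that(2)] einj[OF that(1,2)] that(3)
    unfolding pieces_def by (metis disjointD)
  define g where "g x = h (e (fst x)) (snd x)" for x
  have "graph_iso (copies m ?H) K"
  proof (rule graph_isoI[OF pair_graph_copies[OF H], of g])
    have "inj_on g ({..<m} \<times> W)"
    proof (rule inj_onI)
      fix a b assume "a \<in> {..<m} \<times> W" "b \<in> {..<m} \<times> W" and eq: "g a = g b"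
      then obtain i u j v where ab: "a = (i, u)" "b = (j, v)" "i < m" "u \<in> W" "j < m" "v \<in> W" by auto
      have "i = j" using apart[OF ab(3,5)] hS[OF ab(3,4)] hS[OF ab(5,6)] eq ab(1,2) by (auto simp: g_def)
      moreover from this have "u = v"
        using eq ab h eF[OF ab(3)] by (auto simp: g_def bij_betw_def inj_on_def)
      ultimately show "a = b" using ab by simp
    qed
    moreover have "g ` ({..<m} \<times> W) = \<Union>F"
    proof (intro set_eqI iffI)
      fix x assume "x \<in> \<Union>F"
      then obtain i where i: "i < m" "x \<in> e i" using e by (auto simp: bij_betw_def)
      moreover have "h (e i) ` W = e i" using h eF[OF i(1)] by (simp add: bij_betw_def)
      ultimately obtain u where "u \<in> W" "x = h (e i) u" by blast
      then show "x \<in> g ` ({..<m} \<times> W)" using i by (auto simp: g_def intro!: rev_image_eqI[of "(i, u)"])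
    next
      fix x assume "x \<in> g ` ({..<m} \<times> W)"
      then obtain i u where "i < m" "u \<in> W" "x = h (e i) u" by (auto simp: g_def)
      then show "x \<in> \<Union>F" using hS[of i u] eF[of i] by blast
    qed
    ultimately show "bij_betw g (pverts (copies m ?H)) (pverts K)"
      by (simp add: bij_betw_def K_def)
    show "parcs K \<subseteq> pverts K \<times> pverts K" using pK by (simp add: pair_graph_iff)
    fix a b assume "a \<in> pverts (copies m ?H)" "b \<in> pverts (copies m ?H)"
    then obtain i u j v where ab: "a = (i, u)" "b = (j, v)" "i < m" "u \<in> W" "j < m" "v \<in> W" by auto
    have "E' (g a) (g b) \<longleftrightarrow> i = j \<and> (u, v) \<in> T"
    proof (cases "i = j")
      case True
      then show ?thesis using h eF[OF ab(3)] ab by (simp add: g_def)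
    next
      case False
      then show ?thesis using apart[OF ab(3,5)] hS[OF ab(3,4)] hS[OF ab(5,6)] ab(1,2) by (simp add: g_def)
    qed
    moreover have "g a \<in> \<Union>F" "g b \<in> \<Union>F" using hS eF ab by (auto simp: g_def)
    ultimately show "(a, b) \<in> parcs (copies m ?H) \<longleftrightarrow> (g a, g b) \<in> parcs K"
      using ab by (auto simp: K_def)
  qed
  then have "graph_iso K (copies m ?H)"
    by (rule digraph_iso_swap[OF wf_with_proj[OF pair_graph_copies[OF H]]])
  then show ?thesis using \<open>K \<in> \<C>\<close> unfolding contains_graph_def by blast
qed

theorem theorem1p4:
  fixes k :: nat and \<C> :: "'a::infinite pair_pre_digraph set"
  assumes "k \<ge> 1" and "vertex_minor_ideal \<C>"
  shows "rank_scattered k \<C> \<longleftrightarrow>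
    (\<forall>H :: 'a pair_pre_digraph.
      pair_graph H \<and> Digraph_Component.connected (with_proj H) \<and> card (pverts H) = k + 1 \<longrightarrow>
      \<not> (\<forall>m\<ge>1. contains_graph \<C> (copies m H)))"
proof -
  have pG: "pair_graph G" if "G \<in> \<C>" for G
    using assms(2) that by (simp add: vertex_minor_ideal_def)
  then have fin: "finite (pverts G)" if "G \<in> \<C>" for G
    using that by (simp add: pair_graph_iff)
  note scattered = rank_scattered_iff[OF assms(1) fin]
  show ?thesis
  proof
    assume "rank_scattered k \<C>"
    then obtain N where N: "\<forall>G\<in>\<C>. narrow (adj G) (pverts G) k N" using scattered by blast
    show "\<forall>H :: 'a pair_pre_digraph.
      pair_graph H \<and> Digraph_Component.connected (with_proj H) \<and> card (pverts H) = k + 1 \<longrightarrow>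
      \<not> (\<forall>m\<ge>1. contains_graph \<C> (copies m H))"
    proof (intro allI impI notI, elim conjE)
      fix H :: "'a pair_pre_digraph"
      assume H: "pair_graph H" "Digraph_Component.connected (with_proj H)" "card (pverts H) = k + 1"
        and "\<forall>m\<ge>1. contains_graph \<C> (copies m H)"
      then have "contains_graph \<C> (copies (2 * N + 1) H)" by simp
      then obtain G where "G \<in> \<C>" "graph_iso G (copies (2 * N + 1) H)"
        unfolding contains_graph_def by blast
      then show False
        using le_if_narrow_copies[OF pG H(1) _ H(3)] N connected_iff_conn[OF H(1)] H(2) by fastforce
    qed
  next
    assume none: "\<forall>H :: 'a pair_pre_digraph.
      pair_graph H \<and> Digraph_Component.connected (with_proj H) \<and> card (pverts H) = k + 1 \<longrightarrow>
      \<not> (\<forall>m\<ge>1. contains_graph \<C> (copies m H))"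
    obtain W :: "'a set" where W: "finite W" "card W = k + 1"
      using infinite_arbitrarily_large[OF infinite_UNIV] by blast
    show "rank_scattered k \<C>"
    proof (rule ccontr)
      assume "\<not> rank_scattered k \<C>"
      then have wide: "\<exists>G\<in>\<C>. \<not> narrow (adj G) (pverts G) k N" for N using scattered by blast
      let ?has = "\<lambda>m T. \<exists>G\<in>\<C>. has_copies (pverts G) (adj G) m W T"
      have ex: "\<exists>T\<in>Pow (W \<times> W). ?has m T" if "m \<ge> 1" for m
      proof -
        obtain N where N: "\<forall>(E :: 'a \<Rightarrow> 'a \<Rightarrow> bool) V. finite V \<and> sgraph E \<and> \<not> narrow E V k N \<longrightarrow>
            has_pieces V E (k + 1) (m * card (Pow (W \<times> W)))"
          using wide_has_pieces[OF assms(1), of "m * card (Pow (W \<times> W))"] by (elim exE) (rule that)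
        obtain G where G: "G \<in> \<C>" "\<not> narrow (adj G) (pverts G) k N" using wide by blast
        then have "has_pieces (pverts G) (adj G) (card W) (m * card (Pow (W \<times> W)))"
          using N fin sgraph_adj[OF pG] W(2) by auto
        then show ?thesis
          using has_copies_pigeonhole[OF fin[OF G(1)] W(1) that] G(1) by blast
      qed
      \<comment> \<open>Having \<open>m\<close> copies implies having fewer, so if each of the finitely many \<open>T\<close> failed for some \<open>m\<close>,
        the maximum of these \<open>m\<close> would fail for all \<open>T\<close>.\<close>
      have "\<exists>T\<in>Pow (W \<times> W). \<forall>m\<ge>1. ?has m T"
      proof (rule ccontr)
        assume "\<not> ?thesis"
        then have "\<forall>T\<in>Pow (W \<times> W). \<exists>m\<ge>1. \<not> ?has m T" by blast
        then obtain m where m: "\<And>T. T \<in> Pow (W \<times> W) \<Longrightarrow> m T \<ge> 1 \<and> \<not> ?has (m T) T" by metis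
        define M where "M = Max (m ` Pow (W \<times> W))"
        have le: "m T \<le> M" if "T \<in> Pow (W \<times> W)" for T
          unfolding M_def using that W(1) by (intro Max_ge) auto
        have "1 \<le> M" using le[of "{}"] m[of "{}"] by fastforce
        then obtain T G where T: "T \<in> Pow (W \<times> W)"
          and G: "G \<in> \<C>" "has_copies (pverts G) (adj G) M W T" using ex by blast
        have "has_copies (pverts G) (adj G) (m T) W T"
          by (rule has_copies_mono[OF G(2) le[OF T]])
        then show False using m[OF T] G(1) by blast
      qed
      then obtain T where T: "T \<subseteq> W \<times> W" and has: "\<And>m. m \<ge> 1 \<Longrightarrow> ?has m T" by blast
      obtain G where "G \<in> \<C>" "has_copies (pverts G) (adj G) 1 W T" using has[of 1] by auto
      note H = has_copies_graph[OF sgraph_adj[OF pG[OF this(1)]] W(1) T this(2)]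
      have "contains_graph \<C> (copies m \<lparr>pverts = W, parcs = T\<rparr>)" if "m \<ge> 1" for m
        using has[OF that] contains_copies[OF assms(2) _ W(1) T _ H(1)] by blast
      then show False
        using none[rule_format, of "\<lparr>pverts = W, parcs = T\<rparr>"] H connected_iff_conn[OF H(1)] W(2) by simp
    qed
  qed
qed

end
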